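(* Let $n\ge2$ be an integer, let $1<p\le n$, and let $X=B(0,1)\setminus\{0\}\subset\mathbf R^n$, endowed with the Euclidean metric and the Lebesgue measure $m_n$. Define $u$ on $X$ by $u(x)=|x|^{1-\frac np}-1$ if $1<p<n$, and $u(x)=\ln\frac1{|x|}$ if $p=n$. Then $u$ is a nonnegative function in $N^{1,L^{p,\infty}}(X,m_n)$, the truncations $u_k=\min(u,k)$ belong to $N^{1,L^{p,\infty}}(X,m_n)$ for all integers $k\ge1$, and $u_k$ does not converge to $u$ in $N^{1,L^{p,\infty}}(X,m_n)$ as $k\to\infty$.
   Context: $B(0,1)$ is the open unit ball. For a measurable $f:X\to[-\infty,\infty]$, $\|f\|_{L^{p,\infty}(X,m_n)}=\sup_{t>0}t\,m_n(\{x\in X:|f(x)|>t\})^{1/p}$, and $L^{p,\infty}(X,m_n)$ is the set of measurable $f$ for which this is finite. Modulus: a curve in $X$ is rectifiable if it has finite length; a rectifiable curve $\gamma$ is parametrized by arc length on $[0,\ell(\gamma)]$, and $\int_\gamma\rho=\int_0^{\ell(\gamma)}\rho(\gamma(s))\,ds$ for Borel $\rho\ge0$. $\Gamma_{\rm rect}$ is the family of all nonconstant rectifiable curves in $X$. For $\Gamma\subset\Gamma_{\rm rect}$, $F(\Gamma)$ is the family of Borel $\rho:X\to[0,\infty]$ with $\int_\gamma\rho\ge1$ for every $\gamma\in\Gamma$, and $\mathrm{Mod}_{p,\infty}(\Gamma)=\inf_{\rho\in F(\Gamma)}\|\rho\|_{L^{p,\infty}(X,m_n)}^p$. A property holds for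 $p,\infty$-almost every curve if it holds on all curves of $\Gamma_{\rm rect}$ outside a family of zero $\mathrm{Mod}_{p,\infty}$. Weak upper gradient: a Borel $g:X\to[0,\infty]$ is a $p,\infty$-weak upper gradient of a Borel $u:X\to[-\infty,\infty]$ if for $p,\infty$-almost every $\gamma\in\Gamma_{\rm rect}$ one has $|u(\gamma(0))-u(\gamma(\ell(\gamma)))|\le\int_\gamma g$ whenever both $u(\gamma(0)),u(\gamma(\ell(\gamma)))$ are finite, and $\int_\gamma g=\infty$ otherwise. Newtonian space: $\widetilde N^{1,L^{p,\infty}}(X,m_n)$ is the space of Borel functions $u\in L^{p,\infty}(X,m_n)$ having a $p,\infty$-weak upper gradient in $L^{p,\infty}(X,m_n)$, with $\|u\|_{N^{1,L^{p,\infty}}}=(\|u\|_{L^{p,\infty}}^{p}+\inf_g\|g\|_{L^{p,\infty}}^{p})^{1/p}$, the infimum over all $p,\infty$-weak upper gradients $g\in L^{p,\infty}(X,m_n)$ of $u$. $N^{1,L^{p,\infty}}(X,m_n)$ is the quotient by $u\sim v\iff\|u-v\|_{N^{1,L^{p,\infty}}}=0$; convergence is with respect to $\|\cdot\|_{N^{1,L^{p,\infty}}}$. *)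

theory Defs
  imports "HOL-Analysis.Analysis"
begin

text \<open>Real powers on \<open>[0,\<infinity>]\<close>, only used with exponents \<open>a > 0\<close>.\<close>

definition ennreal_rpow :: "ennreal \<Rightarrow> real \<Rightarrow> ennreal" where
  "ennreal_rpow x a = (if x = \<infinity> then \<infinity> else ennreal (enn2real x powr a))"

section \<open>Weak Lebesgue spaces\<close>

text \<open>Functions on \<open>X\<close> are total functions of which only the values on \<open>X\<close> matter.\<close>

definition weak_Lp_norm :: "real \<Rightarrow> 'a::euclidean_space set \<Rightarrow> ('a \<Rightarrow> ereal) \<Rightarrow> ennreal" where
  "weak_Lp_norm p X f =
     (SUP t\<in>{0<..}. ennreal t * ennreal_rpow (emeasure lebesgue {x\<in>X. ereal t < \<bar>f x\<bar>}) (1 / p))"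

definition weak_Lp :: "real \<Rightarrow> 'a::euclidean_space set \<Rightarrow> ('a \<Rightarrow> ereal) set" where
  "weak_Lp p X = {f \<in> borel_measurable (lebesgue_on X). weak_Lp_norm p X f < \<infinity>}"

section \<open>Rectifiable curves and line integrals\<close>

definition curve_length :: "(real \<Rightarrow> 'a::metric_space) \<Rightarrow> real \<Rightarrow> real \<Rightarrow> ennreal" where
  "curve_length \<gamma> a b =
     (SUP (m, \<tau>) \<in> {(m :: nat, \<tau>). mono_on {..m} \<tau> \<and> \<tau> ` {..m} \<subseteq> {a..b}}.
        \<Sum>i<m. ennreal (dist (\<gamma> (\<tau> i)) (\<gamma> (\<tau> (Suc i)))))"

definition rectifiable_curves :: "'a::metric_space set \<Rightarrow> (real \<Rightarrow> 'a) set" where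
  "rectifiable_curves X =
     {\<gamma>. path \<gamma> \<and> path_image \<gamma> \<subseteq> X \<and> curve_length \<gamma> 0 1 < \<infinity> \<and> \<not> \<gamma> constant_on {0..1}}"

text \<open>The choice of the parameter \<open>t\<close> is immaterial: \<open>\<gamma>\<close> is constant on every interval on
  which its length does not grow.\<close>

definition arc_length_param :: "(real \<Rightarrow> 'a::metric_space) \<Rightarrow> real \<Rightarrow> 'a" where
  "arc_length_param \<gamma> s = \<gamma> (SOME t. t \<in> {0..1} \<and> curve_length \<gamma> 0 t = ennreal s)"

definition curve_integral :: "(real \<Rightarrow> 'a::metric_space) \<Rightarrow> ('a \<Rightarrow> ennreal) \<Rightarrow> ennreal" where
  "curve_integral \<gamma> \<rho> =
     (\<integral>\<^sup>+ s\<in>{0..enn2real (curve_length \<gamma> 0 1)}. \<rho> (arc_length_param \<gamma> s) \<partial>lborel)"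

section \<open>Modulus\<close>

definition admissible_densities ::
    "'a::euclidean_space set \<Rightarrow> (real \<Rightarrow> 'a) set \<Rightarrow> ('a \<Rightarrow> ennreal) set" where
  "admissible_densities X \<Gamma> =
     {\<rho> \<in> borel_measurable (restrict_space borel X). \<forall>\<gamma>\<in>\<Gamma>. 1 \<le> curve_integral \<gamma> \<rho>}"

definition weak_modulus :: "real \<Rightarrow> 'a::euclidean_space set \<Rightarrow> (real \<Rightarrow> 'a) set \<Rightarrow> ennreal" where
  "weak_modulus p X \<Gamma> =
     (INF \<rho>\<in>admissible_densities X \<Gamma>. ennreal_rpow (weak_Lp_norm p X (\<lambda>x. enn2ereal (\<rho> x))) p)"

definition almost_every_curve ::
    "real \<Rightarrow> 'a::euclidean_space set \<Rightarrow> ((real \<Rightarrow> 'a) \<Rightarrow> bool) \<Rightarrow> bool" where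
  "almost_every_curve p X P \<longleftrightarrow>
     (\<exists>\<Gamma>\<subseteq>rectifiable_curves X. weak_modulus p X \<Gamma> = 0 \<and> (\<forall>\<gamma>\<in>rectifiable_curves X - \<Gamma>. P \<gamma>))"

section \<open>Weak upper gradients and Newtonian spaces\<close>

definition weak_upper_gradient ::
    "real \<Rightarrow> 'a::euclidean_space set \<Rightarrow> ('a \<Rightarrow> ereal) \<Rightarrow> ('a \<Rightarrow> ennreal) \<Rightarrow> bool" where
  "weak_upper_gradient p X u g \<longleftrightarrow>
     g \<in> borel_measurable (restrict_space borel X) \<and>
     almost_every_curve p X (\<lambda>\<gamma>.
       if \<bar>u (pathstart \<gamma>)\<bar> \<noteq> \<infinity> \<and> \<bar>u (pathfinish \<gamma>)\<bar> \<noteq> \<infinity>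
       then \<bar>u (pathstart \<gamma>) - u (pathfinish \<gamma>)\<bar> \<le> enn2ereal (curve_integral \<gamma> g)
       else curve_integral \<gamma> g = \<infinity>)"

definition Lp_weak_upper_gradients ::
    "real \<Rightarrow> 'a::euclidean_space set \<Rightarrow> ('a \<Rightarrow> ereal) \<Rightarrow> ('a \<Rightarrow> ennreal) set" where
  "Lp_weak_upper_gradients p X u =
     {g. weak_upper_gradient p X u g \<and> (\<lambda>x. enn2ereal (g x)) \<in> weak_Lp p X}"

definition newtonian_norm :: "real \<Rightarrow> 'a::euclidean_space set \<Rightarrow> ('a \<Rightarrow> ereal) \<Rightarrow> ennreal" where
  "newtonian_norm p X u =
     ennreal_rpow
       (ennreal_rpow (weak_Lp_norm p X u) p +
        (INF g\<in>Lp_weak_upper_gradients p X u.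
           ennreal_rpow (weak_Lp_norm p X (\<lambda>x. enn2ereal (g x))) p))
       (1 / p)"

text \<open>The space of functions, before passing to the quotient.\<close>

definition newtonian_functions :: "real \<Rightarrow> 'a::euclidean_space set \<Rightarrow> ('a \<Rightarrow> ereal) set" where
  "newtonian_functions p X =
     {u \<in> borel_measurable (restrict_space borel X).
        u \<in> weak_Lp p X \<and> Lp_weak_upper_gradients p X u \<noteq> {}}"

text \<open>In \<^typ>\<open>ereal\<close>, \<open>\<infinity> - \<infinity> = \<infinity>\<close>. The convention chosen for \<open>u - v\<close> at such points does not affect
  the norm below: a function in \<^const>\<open>newtonian_functions\<close> is finite almost everywhere, and almost
  every curve has no endpoint at which it is infinite.\<close>

definition newtonian_rel ::
    "real \<Rightarrow> 'a::euclidean_space set \<Rightarrow> (('a \<Rightarrow> ereal) \<times> ('a \<Rightarrow> ereal)) set" where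
  "newtonian_rel p X =
     {(u, v). u \<in> newtonian_functions p X \<and> v \<in> newtonian_functions p X \<and>
              newtonian_norm p X (\<lambda>x. u x - v x) = 0}"

definition newtonian_space :: "real \<Rightarrow> 'a::euclidean_space set \<Rightarrow> ('a \<Rightarrow> ereal) set set" where
  "newtonian_space p X = newtonian_functions p X // newtonian_rel p X"

definition newtonian_class ::
    "real \<Rightarrow> 'a::euclidean_space set \<Rightarrow> ('a \<Rightarrow> ereal) \<Rightarrow> ('a \<Rightarrow> ereal) set" where
  "newtonian_class p X u = newtonian_rel p X `` {u}"

text \<open>The norm of the difference of two classes. It does not depend on the representatives, so the
  infimum is over a single value.\<close>

definition newtonian_dist ::
    "real \<Rightarrow> 'a::euclidean_space set \<Rightarrow> ('a \<Rightarrow> ereal) set \<Rightarrow> ('a \<Rightarrow> ereal) set \<Rightarrow> ennreal" where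
  "newtonian_dist p X U V = (INF (u, v)\<in>U \<times> V. newtonian_norm p X (\<lambda>x. u x - v x))"

definition newtonian_converges ::
    "real \<Rightarrow> 'a::euclidean_space set \<Rightarrow> (nat \<Rightarrow> ('a \<Rightarrow> ereal) set) \<Rightarrow> ('a \<Rightarrow> ereal) set \<Rightarrow> bool" where
  "newtonian_converges p X U V \<longleftrightarrow> (\<lambda>k. newtonian_dist p X (U k) V) \<longlonglongrightarrow> 0"

end

theory Submission
  imports Defs
begin

text \<open>
  The function \<open>u\<close> and its truncations \<open>min u k\<close> have the common upper gradient
  \<open>n / p * norm x powr (- n / p)\<close>, which belongs to weak \<open>L\<^sup>p\<close> but not to \<open>L\<^sup>p\<close>: its superlevel sets at
  large heights \<open>t\<close> are punctured balls, and \<open>t powr p\<close> times their volume is constant. For this reason cutting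
  \<open>u\<close> off near the origin does not make the gradient small. The difference \<open>u - min u k\<close> lives on a tiny
  ball, but there its gradient has, up to rescaling, the same size as before, and the weak norm is
  invariant under exactly this rescaling.

  Membership (\<open>newtonian_functionsI\<close>) needs that a pointwise Lipschitz bound is an upper gradient
  (\<open>increment_le_curve_integral\<close>). As line integrals are taken with respect to arc length, this requires
  that the length of an initial piece of a rectifiable curve depends continuously on its endpoint
  (\<open>continuous_len\<close>).

  Failure of convergence follows from a lower bound, independent of \<open>k\<close>, for the weak norm of any weak upper
  gradient \<open>g\<close> of the difference (\<open>weak_upper_gradient_lower_bound\<close>). At a small scale \<open>s\<close> a ball of
  segments leads away from the origin, and \<open>u\<close> drops by \<open>\<kappa> * s powr (1 - n / p)\<close> along each. The mean of
  the integrals of \<open>g\<close> along them is at least this drop (\<open>weak_upper_gradient_flow_integral\<close>), and at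
  most what the weak norm permits on a set of volume of order \<open>s ^ n\<close> (\<open>flow_integral_le\<close>, by the layer cake
  formula). Both sides have the same order in \<open>s\<close>, so the weak norm cannot be small. The
  argument sees only values almost everywhere, and therefore applies to all representatives
  of the classes.
\<close>

section \<open>Length of curves and the arc length parametrization\<close>

definition inscribed :: "real \<Rightarrow> real \<Rightarrow> nat \<Rightarrow> (nat \<Rightarrow> real) \<Rightarrow> bool" where
  "inscribed a b m \<tau> \<longleftrightarrow> mono_on {..m} \<tau> \<and> \<tau> ` {..m} \<subseteq> {a..b}"

definition polygon_length :: "(real \<Rightarrow> 'a::metric_space) \<Rightarrow> nat \<Rightarrow> (nat \<Rightarrow> real) \<Rightarrow> real" where
  "polygon_length \<gamma> m \<tau> = (\<Sum>i<m. dist (\<gamma> (\<tau> i)) (\<gamma> (\<tau> (Suc i))))"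

lemma polygon_length_nonneg [simp]: "0 \<le> polygon_length \<gamma> m \<tau>"
  by (simp add: polygon_length_def sum_nonneg)

lemma curve_length_eq:
  "curve_length \<gamma> a b = (SUP (m, \<tau>) \<in> {(m, \<tau>). inscribed a b m \<tau>}. ennreal (polygon_length \<gamma> m \<tau>))"
  unfolding curve_length_def inscribed_def polygon_length_def by (simp add: sum_ennreal)

lemma polygon_length_le_curve_length:
  "inscribed a b m \<tau> \<Longrightarrow> ennreal (polygon_length \<gamma> m \<tau>) \<le> curve_length \<gamma> a b"
  unfolding curve_length_eq by (rule SUP_upper2[where i="(m, \<tau>)"]) auto

lemma curve_length_least:
  "(\<And>m \<tau>. inscribed a b m \<tau> \<Longrightarrow> ennreal (polygon_length \<gamma> m \<tau>) \<le> z) \<Longrightarrow> curve_length \<gamma> a b \<le> z"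
  unfolding curve_length_eq by (rule SUP_least) auto

lemma dist_le_curve_length:
  assumes "a \<le> b"
  shows "ennreal (dist (\<gamma> a) (\<gamma> b)) \<le> curve_length \<gamma> a b"
proof -
  define \<tau> where "\<tau> i = (if i = 0 then a else b)" for i :: nat
  have "inscribed a b 1 \<tau>"
    using assms by (auto simp: inscribed_def \<tau>_def mono_on_def)
  from polygon_length_le_curve_length[OF this, of \<gamma>] show ?thesis
    by (simp add: polygon_length_def \<tau>_def)
qed

text \<open>Clamping all nodes at \<open>b\<close>, from above and from below, splits a subdivision of \<open>[a, c]\<close> into one of
  \<open>[a, b]\<close> and one of \<open>[b, c]\<close> without any reindexing, and the clamped polygon depends continuously on
  \<open>b\<close>. Additivity and continuity of the length both rest on this.\<close>

lemma inscribed_clamp: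
  assumes "inscribed a c m \<tau>" "a \<le> b" "b \<le> c"
  shows "inscribed a b m (\<lambda>i. min b (\<tau> i))" "inscribed b c m (\<lambda>i. max b (\<tau> i))"
proof -
  have t: "mono_on {..m} \<tau>" "\<And>i. i \<le> m \<Longrightarrow> a \<le> \<tau> i \<and> \<tau> i \<le> c"
    using assms(1) by (auto simp: inscribed_def)
  show "inscribed a b m (\<lambda>i. min b (\<tau> i))" "inscribed b c m (\<lambda>i. max b (\<tau> i))"
    using t(2) assms(2,3) monotone_onD[OF t(1)]
    by (auto simp: inscribed_def intro!: monotone_onI min.mono max.mono) 
qed

text \<open>At most one edge straddles \<open>b\<close>; that edge is bounded by the triangle inequality through \<open>\<gamma> b\<close>, and
  every other edge survives in exactly one of the two clamped polygons.\<close>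

lemma polygon_length_clamp:
  assumes "inscribed a c m \<tau>"
  shows "polygon_length \<gamma> m \<tau>
    \<le> polygon_length \<gamma> m (\<lambda>i. min b (\<tau> i)) + polygon_length \<gamma> m (\<lambda>i. max b (\<tau> i))"
  unfolding polygon_length_def sum.distrib[symmetric]
proof (rule sum_mono)
  fix i assume "i \<in> {..<m}"
  then have "\<tau> i \<le> \<tau> (Suc i)"
    using assms by (auto simp: inscribed_def intro: mono_onD)
  then show "dist (\<gamma> (\<tau> i)) (\<gamma> (\<tau> (Suc i))) \<le>
      dist (\<gamma> (min b (\<tau> i))) (\<gamma> (min b (\<tau> (Suc i)))) +
      dist (\<gamma> (max b (\<tau> i))) (\<gamma> (max b (\<tau> (Suc i))))"
    using dist_triangle[of "\<gamma> (\<tau> i)" "\<gamma> (\<tau> (Suc i))" "\<gamma> b"]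
    by (cases "b \<le> \<tau> i"; cases "b \<le> \<tau> (Suc i)") (auto simp: min_def max_def)
qed

lemma SUP_add_SUP_le:
  fixes f :: "'i \<Rightarrow> ennreal" and g :: "'j \<Rightarrow> ennreal"
  assumes "I \<noteq> {}" "J \<noteq> {}" "\<And>i j. i \<in> I \<Longrightarrow> j \<in> J \<Longrightarrow> f i + g j \<le> z"
  shows "(SUP i\<in>I. f i) + (SUP j\<in>J. g j) \<le> z"
proof -
  have "f i + (SUP j\<in>J. g j) \<le> z" if "i \<in> I" for i
    unfolding ennreal_SUP_add_right[OF assms(2)] by (intro SUP_least assms(3) that)
  then show ?thesis
    unfolding ennreal_SUP_add_left[OF assms(1), symmetric] by (intro SUP_least)
qed

lemma curve_length_superadditive:
  assumes "a \<le> b" "b \<le> c"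
  shows "curve_length \<gamma> a b + curve_length \<gamma> b c \<le> curve_length \<gamma> a c"
proof -
  have concat: "ennreal (polygon_length \<gamma> m \<sigma>) + ennreal (polygon_length \<gamma> k \<tau>) \<le> curve_length \<gamma> a c"
    if s: "inscribed a b m \<sigma>" and t: "inscribed b c k \<tau>" for m \<sigma> k \<tau>
  proof -
    \<comment> \<open>the nodes of \<open>\<sigma>\<close> followed by those of \<open>\<tau>\<close>; the extra edge joining them only adds length\<close>
    define \<theta> where "\<theta> i = (if i \<le> m then \<sigma> i else \<tau> (i - Suc m))" for i
    have sb: "\<And>i. i \<le> m \<Longrightarrow> a \<le> \<sigma> i \<and> \<sigma> i \<le> b" and tb: "\<And>i. i \<le> k \<Longrightarrow> b \<le> \<tau> i \<and> \<tau> i \<le> c"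
      and sm: "\<And>i j. i \<le> j \<Longrightarrow> j \<le> m \<Longrightarrow> \<sigma> i \<le> \<sigma> j" and tm: "\<And>i j. i \<le> j \<Longrightarrow> j \<le> k \<Longrightarrow> \<tau> i \<le> \<tau> j"
      using s t by (auto simp: inscribed_def mono_on_def)
    have mono: "\<theta> i \<le> \<theta> j" if "i \<le> j" "j \<le> Suc m + k" for i j
    proof -
      consider "j \<le> m" | "i \<le> m" "\<not> j \<le> m" | "\<not> i \<le> m" using that by linarith
      then show ?thesis
      proof cases
        case 2
        moreover from this have "j - Suc m \<le> k" using that by arith
        ultimately show ?thesis using sb[of i] tb[of "j - Suc m"] by (simp add: \<theta>_def)
      qed (use that in \<open>auto simp: \<theta>_def intro!: sm tm\<close>)
    qed
    have "a \<le> \<theta> i \<and> \<theta> i \<le> c" if "i \<le> Suc m + k" for i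
    proof -
      have "i - Suc m \<le> k" using that by arith
      then show ?thesis
        using sb[of i] tb[of "i - Suc m"] assms by (auto simp: \<theta>_def)
    qed
    with mono have "inscribed a c (Suc m + k) \<theta>"
      by (auto simp: inscribed_def intro!: mono_onI)
    moreover have "polygon_length \<gamma> m \<sigma> + polygon_length \<gamma> k \<tau> \<le> polygon_length \<gamma> (Suc m + k) \<theta>"
    proof -
      let ?d = "\<lambda>i. dist (\<gamma> (\<theta> i)) (\<gamma> (\<theta> (Suc i)))"
      have "polygon_length \<gamma> (Suc m + k) \<theta> = (\<Sum>i<m. ?d i) + ?d m + (\<Sum>i<k. ?d (Suc m + i))"
        unfolding polygon_length_def
        by (induction k) auto
      moreover have "(\<Sum>i<m. ?d i) = polygon_length \<gamma> m \<sigma>"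
        unfolding polygon_length_def by (intro sum.cong) (auto simp: \<theta>_def)
      moreover have "(\<Sum>i<k. ?d (Suc m + i)) = polygon_length \<gamma> k \<tau>"
        unfolding polygon_length_def by (intro sum.cong) (auto simp: \<theta>_def)
      ultimately show ?thesis by simp
    qed
    ultimately show ?thesis
      using polygon_length_le_curve_length[of a c "Suc m + k" \<theta> \<gamma>]
      by (auto simp flip: ennreal_plus intro: order_trans ennreal_leI)
  qed
  have ne: "{(m, \<tau>). inscribed a' b' m \<tau>} \<noteq> {}" if "a' \<le> b'" for a' b'
    using that by (auto intro!: exI[of _ 0] exI[of _ "\<lambda>_. a'"] simp: inscribed_def mono_on_def)
  show ?thesis
    unfolding curve_length_eq[of \<gamma> a b] curve_length_eq[of \<gamma> b c]
    by (rule SUP_add_SUP_le[OF ne[OF assms(1)] ne[OF assms(2)]]) (auto simp: concat)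
qed

lemma curve_length_add:
  assumes "a \<le> b" "b \<le> c"
  shows "curve_length \<gamma> a c = curve_length \<gamma> a b + curve_length \<gamma> b c"
proof (rule antisym[OF _ curve_length_superadditive[OF assms]], rule curve_length_least)
  fix m \<tau> assume t: "inscribed a c m \<tau>"
  have "ennreal (polygon_length \<gamma> m \<tau>)
      \<le> ennreal (polygon_length \<gamma> m (\<lambda>i. min b (\<tau> i))) + ennreal (polygon_length \<gamma> m (\<lambda>i. max b (\<tau> i)))"
    using polygon_length_clamp[OF t, of \<gamma> b] by (simp flip: ennreal_plus add: ennreal_leI)
  also have "\<dots> \<le> curve_length \<gamma> a b + curve_length \<gamma> b c"
    by (intro add_mono polygon_length_le_curve_length inscribed_clamp[OF t assms])
  finally show "ennreal (polygon_length \<gamma> m \<tau>) \<le> curve_length \<gamma> a b + curve_length \<gamma> b c" .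
qed

lemma curve_length_refl: "curve_length \<gamma> a a = 0"
proof -
  have "curve_length \<gamma> a a \<le> 0"
  proof (rule curve_length_least)
    fix m \<tau> assume "inscribed a a m \<tau>"
    then have "\<tau> i = a" if "i \<le> m" for i
      using that by (auto simp: inscribed_def)
    then show "ennreal (polygon_length \<gamma> m \<tau>) \<le> 0"
      by (simp add: polygon_length_def)
  qed
  then show ?thesis by simp
qed

text \<open>The metric consequences of finite length. Constant curves are allowed here, in contrast to
  \<^const>\<open>rectifiable_curves\<close>.\<close>

locale rectifiable_curve =
  fixes \<gamma> :: "real \<Rightarrow> 'a::metric_space"
  assumes path: "path \<gamma>" and finite_length: "curve_length \<gamma> 0 1 < \<infinity>"
begin

definition len :: "real \<Rightarrow> real" where
  "len t = enn2real (curve_length \<gamma> 0 t)"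

lemma finite_sublength:
  assumes "0 \<le> s" "s \<le> t" "t \<le> 1"
  shows "curve_length \<gamma> s t < \<infinity>"
proof -
  have "curve_length \<gamma> s t \<le> curve_length \<gamma> 0 t"
    using curve_length_add[of 0 s t \<gamma>] assms by simp
  also have "\<dots> \<le> curve_length \<gamma> 0 1"
    using curve_length_add[of 0 t 1 \<gamma>] assms by simp
  finally show ?thesis using finite_length by (simp add: order_le_less_trans)
qed

lemma ennreal_len: "0 \<le> t \<Longrightarrow> t \<le> 1 \<Longrightarrow> ennreal (len t) = curve_length \<gamma> 0 t"
  using finite_sublength[of 0 t] by (simp add: len_def ennreal_enn2real_if less_top)

lemma len_0 [simp]: "len 0 = 0"
  by (simp add: len_def curve_length_refl)

lemma len_nonneg [simp]: "0 \<le> len t"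
  by (simp add: len_def)

lemma curve_length_eq_len:
  assumes "0 \<le> s" "s \<le> t" "t \<le> 1"
  shows "curve_length \<gamma> s t = ennreal (len t - len s)" "len s \<le> len t"
proof -
  have e: "ennreal (len t) = ennreal (len s) + curve_length \<gamma> s t"
    using curve_length_add[of 0 s t \<gamma>] assms by (simp add: ennreal_len)
  obtain r where r: "0 \<le> r" "curve_length \<gamma> s t = ennreal r"
    using finite_sublength[OF assms] by (cases "curve_length \<gamma> s t") auto
  with e have "len t = len s + r"
    by (simp flip: ennreal_plus)
  with r show "curve_length \<gamma> s t = ennreal (len t - len s)" "len s \<le> len t" by auto
qed

lemma dist_le_len:
  assumes "s \<in> {0..1}" "t \<in> {0..1}"
  shows "dist (\<gamma> s) (\<gamma> t) \<le> \<bar>len s - len t\<bar>"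
proof -
  have *: "dist (\<gamma> s) (\<gamma> t) \<le> len t - len s" if "0 \<le> s" "s \<le> t" "t \<le> 1" for s t
    using dist_le_curve_length[OF that(2), of \<gamma>] curve_length_eq_len[OF that] by simp
  show ?thesis
    using *[of s t] *[of t s] assms by (cases "s \<le> t") (auto simp: dist_commute)
qed

text \<open>Choose polygons inscribed in the whole curve that are within \<open>1 / (n + 1)\<close> of its length. Clamped
  at \<open>t\<close> from above and from below, they are at most as long as the two parts of the curve, and together
  at least as long as the original polygon. So neither falls short by more than \<open>1 / (n + 1)\<close>, whatever
  \<open>t\<close> is: the length is a uniform limit of functions that are continuous because \<open>\<gamma>\<close> is.\<close>

lemma continuous_len: "continuous_on {0..1} len"
proof -
  have cont: "continuous_on {0..1} \<gamma>"
    using path by (simp add: path_def)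
  have "\<exists>m \<tau>. inscribed 0 1 m \<tau> \<and> len 1 - inverse (real (Suc n)) < polygon_length \<gamma> m \<tau>" for n
  proof (rule ccontr)
    assume neg: "\<not> ?thesis"
    have "curve_length \<gamma> 0 1 \<le> ennreal (len 1 - inverse (real (Suc n)))"
    proof (rule curve_length_least)
      fix m \<tau> assume "inscribed 0 1 m \<tau>"
      with neg have "polygon_length \<gamma> m \<tau> \<le> len 1 - inverse (real (Suc n))" by force
      then show "ennreal (polygon_length \<gamma> m \<tau>) \<le> ennreal (len 1 - inverse (real (Suc n)))"
        by (rule ennreal_leI)
    qed
    moreover have "0 \<le> len 1 - inverse (real (Suc n))"
    proof -
      have "inscribed 0 1 0 (\<lambda>_. 0)" by (simp add: inscribed_def mono_on_def)
      with neg show ?thesis by (force simp: polygon_length_def)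
    qed
    ultimately show False
      by (simp flip: ennreal_len)
  qed
  then obtain m \<tau> where ins: "\<And>n. inscribed 0 1 (m n) (\<tau> n)"
    and close: "\<And>n. len 1 - inverse (real (Suc n)) < polygon_length \<gamma> (m n) (\<tau> n)"
    by metis
  define S where "S n t = polygon_length \<gamma> (m n) (\<lambda>i. min t (\<tau> n i))" for n t
  have S_cont: "continuous_on {0..1} (S n)" for n
    unfolding S_def polygon_length_def
  proof (intro continuous_intros)
    fix i assume "i \<in> {..<m n}"
    have *: "continuous_on {0..1} (\<lambda>t. \<gamma> (min t (\<tau> n j)))" if "j \<le> m n" for j
      using ins[of n] that
      by (intro continuous_on_compose2[OF cont] continuous_intros) (force simp: inscribed_def)
    show "continuous_on {0..1} (\<lambda>t. \<gamma> (min t (\<tau> n i)))" "continuous_on {0..1} (\<lambda>t. \<gamma> (min t (\<tau> n (Suc i))))"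
      using \<open>i \<in> {..<m n}\<close> by (auto intro!: *)
  qed
  have close': "\<bar>S n t - len t\<bar> \<le> inverse (real (Suc n))" if t: "t \<in> {0..1}" for n t
  proof -
    have t': "0 \<le> t" "t \<le> 1" using t by auto
    let ?T = "polygon_length \<gamma> (m n) (\<lambda>i. max t (\<tau> n i))"
    have "S n t \<le> len t"
      using polygon_length_le_curve_length[OF inscribed_clamp(1)[OF ins t'], of \<gamma>] t'
      by (simp add: S_def flip: ennreal_len)
    moreover have "?T \<le> len 1 - len t"
      using polygon_length_le_curve_length[OF inscribed_clamp(2)[OF ins t'], of \<gamma>] t'
        curve_length_eq_len[OF t'] by simp
    moreover have "polygon_length \<gamma> (m n) (\<tau> n) \<le> S n t + ?T"
      unfolding S_def by (rule polygon_length_clamp[OF ins])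
    ultimately show ?thesis using close[of n] by linarith
  qed
  have "uniform_limit {0..1} S len sequentially"
  proof (rule uniform_limitI)
    fix e :: real assume "0 < e"
    then have "\<forall>\<^sub>F n in sequentially. inverse (real (Suc n)) < e"
      using LIMSEQ_inverse_real_of_nat order_tendstoD(2) by blast
    then show "\<forall>\<^sub>F n in sequentially. \<forall>x\<in>{0..1}. dist (S n x) (len x) < e"
      by eventually_elim (auto simp: dist_real_def intro: le_less_trans[OF close'])
  qed
  then show ?thesis
    by (rule uniform_limit_theorem[rotated]) (auto intro!: always_eventually S_cont)
qed

text \<open>Continuity of the length is what makes the choice in \<^const>\<open>arc_length_param\<close> meaningful: by the
  intermediate value theorem, a parameter of the prescribed length exists.\<close>

lemma arc_length_param_obtain:
  assumes "s \<in> {0..len 1}"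
  obtains t where "t \<in> {0..1}" "len t = s" "arc_length_param \<gamma> s = \<gamma> t"
proof -
  have "\<exists>t. 0 \<le> t \<and> t \<le> 1 \<and> len t = s"
    using assms by (intro IVT' continuous_len) auto
  then have "\<exists>t. t \<in> {0..1} \<and> curve_length \<gamma> 0 t = ennreal s"
    by (metis atLeastAtMost_iff ennreal_len)
  then have *: "(SOME t. t \<in> {0..1} \<and> curve_length \<gamma> 0 t = ennreal s) \<in> {0..1} \<and>
      curve_length \<gamma> 0 (SOME t. t \<in> {0..1} \<and> curve_length \<gamma> 0 t = ennreal s) = ennreal s"
    by (rule someI_ex)
  show ?thesis
    by (rule that[OF conjunct1[OF *] _ arc_length_param_def]) (use * assms in \<open>simp add: len_def\<close>)
qed

lemma arc_length_param_Lipschitz: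
  assumes "s \<in> {0..len 1}" "t \<in> {0..len 1}"
  shows "dist (arc_length_param \<gamma> s) (arc_length_param \<gamma> t) \<le> \<bar>s - t\<bar>"
  using assms by (metis arc_length_param_obtain dist_le_len)

lemma arc_length_param_mem: "s \<in> {0..len 1} \<Longrightarrow> arc_length_param \<gamma> s \<in> path_image \<gamma>"
  by (metis arc_length_param_obtain path_image_def imageI)

lemma arc_length_param_len:
  assumes "t \<in> {0..1}"
  shows "arc_length_param \<gamma> (len t) = \<gamma> t"
proof -
  have "len t \<in> {0..len 1}"
    using assms curve_length_eq_len(2)[of t 1] by simp
  then obtain r where "r \<in> {0..1}" "len r = len t" "arc_length_param \<gamma> (len t) = \<gamma> r"
    by (rule arc_length_param_obtain)
  with dist_le_len[of r t] assms show ?thesis by simp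
qed

end

section \<open>Line integrals and pointwise Lipschitz bounds\<close>

context rectifiable_curve
begin

lemma curve_integral_eq:
  "curve_integral \<gamma> \<rho> = (\<integral>\<^sup>+ s\<in>{0..len 1}. \<rho> (arc_length_param \<gamma> s) \<partial>lborel)"
  by (simp add: curve_integral_def len_def)

lemma curve_integral_cong:
  assumes "\<And>x. x \<in> path_image \<gamma> \<Longrightarrow> \<rho> x = \<rho>' x"
  shows "curve_integral \<gamma> \<rho> = curve_integral \<gamma> \<rho>'"
  unfolding curve_integral_eq
  by (intro nn_integral_cong) (auto simp: indicator_def assms arc_length_param_mem)

text \<open>If \<open>G\<close> bounds the pointwise Lipschitz constant of \<open>f\<close>, then \<open>G\<close> is an upper gradient. Along the
  1-Lipschitz arc length parametrization, on a short interval around \<open>x\<close>, the increment of \<open>f\<close> exceeds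
  the integral of \<open>G\<close> by at most \<open>e\<close> times the length. This bound is additive in the interval, so
  bisection propagates it to the whole curve; no differentiability almost everywhere is used.\<close>

lemma increment_le_curve_integral:
  fixes f G :: "'a \<Rightarrow> real"
  assumes X: "path_image \<gamma> \<subseteq> X" and G: "continuous_on X G" "\<And>x. x \<in> X \<Longrightarrow> 0 \<le> G x"
    and local: "\<And>x e. x \<in> X \<Longrightarrow> 0 < e \<Longrightarrow>
      \<exists>d>0. \<forall>y\<in>X \<inter> ball x d. \<forall>z\<in>X \<inter> ball x d. \<bar>f y - f z\<bar> \<le> (G x + e) * dist y z"
  shows "ennreal \<bar>f (pathstart \<gamma>) - f (pathfinish \<gamma>)\<bar> \<le> curve_integral \<gamma> (\<lambda>x. ennreal (G x))"
proof -
  define c where "c = arc_length_param \<gamma>"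
  define l where "l = len 1"
  have l: "0 \<le> l" by (simp add: l_def)
  have c_X: "c s \<in> X" if "s \<in> {0..l}" for s
    using arc_length_param_mem[of s] X that by (auto simp: c_def l_def)
  have c_Lip: "dist (c s) (c t) \<le> \<bar>s - t\<bar>" if "s \<in> {0..l}" "t \<in> {0..l}" for s t
    using arc_length_param_Lipschitz that by (simp add: c_def l_def)
  have "1-lipschitz_on {0..l} c"
    by (rule lipschitz_onI) (auto simp: dist_real_def intro!: c_Lip)
  then have "continuous_on {0..l} c"
    by (rule lipschitz_on_continuous_on)
  then have cont: "continuous_on {0..l} (\<lambda>s. G (c s))"
    by (intro continuous_on_compose2[OF G(1)]) (auto intro!: c_X)
  have int: "(\<lambda>s. G (c s)) integrable_on {a..b}" if "0 \<le> a" "b \<le> l" for a b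
    using that by (intro integrable_continuous_real continuous_on_subset[OF cont]) auto
  let ?I = "\<lambda>a b. integral {a..b} (\<lambda>s. G (c s))"
  have approx: "\<bar>f (c 0) - f (c l)\<bar> \<le> ?I 0 l + e * (l - 0)" if e: "0 < e" for e
  proof -
    define P where "P a b \<longleftrightarrow> (0 \<le> a \<and> b \<le> l \<longrightarrow> \<bar>f (c a) - f (c b)\<bar> \<le> ?I a b + e * (b - a))" for a b
    have "P 0 l"
      using l
    proof (induct rule: Bolzano)
      case (trans r s t)
      show ?case unfolding P_def
      proof (intro impI, elim conjE)
        assume "0 \<le> r" "t \<le> l"
        with trans(1,2)[unfolded P_def] trans(3,4) have "\<bar>f (c r) - f (c s)\<bar> \<le> ?I r s + e * (s - r)"
            "\<bar>f (c s) - f (c t)\<bar> \<le> ?I s t + e * (t - s)" by auto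
        moreover have "?I r s + ?I s t = ?I r t"
          using \<open>0 \<le> r\<close> \<open>t \<le> l\<close> trans by (intro Henstock_Kurzweil_Integration.integral_combine int) auto
        ultimately show "\<bar>f (c r) - f (c t)\<bar> \<le> ?I r t + e * (t - r)"
          by (simp add: algebra_simps)
      qed
    next
      case (local x)
      then have x: "c x \<in> X" by (auto intro: c_X)
      obtain d1 where d1: "d1 > 0"
        "\<And>y z. y \<in> X \<inter> ball (c x) d1 \<Longrightarrow> z \<in> X \<inter> ball (c x) d1 \<Longrightarrow> \<bar>f y - f z\<bar> \<le> (G (c x) + e / 2) * dist y z"
        using assms(4)[OF x, of "e / 2"] e by auto
      obtain d2 where d2: "d2 > 0" "\<And>y. y \<in> X \<Longrightarrow> dist y (c x) < d2 \<Longrightarrow> \<bar>G y - G (c x)\<bar> < e / 2"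
        using G(1) x e unfolding continuous_on_iff dist_real_def by (meson half_gt_zero)
      show ?case unfolding P_def
      proof (intro exI[of _ "min d1 d2"] conjI allI impI)
        fix a b assume ab: "a \<le> x \<and> x \<le> b \<and> b - a < min d1 d2" "0 \<le> a \<and> b \<le> l"
        have near: "c s \<in> X" "dist (c s) (c x) < d1" "dist (c s) (c x) < d2" if "s \<in> {a..b}" for s
        proof -
          have "dist (c s) (c x) \<le> \<bar>s - x\<bar>"
            using ab that by (intro c_Lip) auto
          also have "\<dots> < min d1 d2" using ab that by auto
          finally show "dist (c s) (c x) < d1" "dist (c s) (c x) < d2" by auto
        qed (use ab that in \<open>auto intro!: c_X\<close>)
        have "\<bar>f (c a) - f (c b)\<bar> \<le> (G (c x) + e / 2) * dist (c a) (c b)"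
          using near[of a] near[of b] ab by (intro d1(2)) (auto simp: dist_commute)
        also have "\<dots> \<le> (G (c x) + e / 2) * (b - a)"
          using c_Lip[of a b] ab G(2)[OF x] e by (intro mult_left_mono) auto
        also have "\<dots> = integral {a..b} (\<lambda>_. G (c x) - e / 2) + e * (b - a)"
          using ab by (simp add: algebra_simps)
        also have "\<dots> \<le> ?I a b + e * (b - a)"
        proof (intro add_right_mono integral_le int)
          fix s assume "s \<in> {a..b}"
          from d2(2)[OF near(1,3)[OF this]] show "G (c x) - e / 2 \<le> G (c s)" by linarith
        qed (use ab in auto)
        finally show "\<bar>f (c a) - f (c b)\<bar> \<le> ?I a b + e * (b - a)" .
      qed (use d1 d2 in auto)
    qed
    then show ?thesis by (simp add: P_def)
  qed
  have "\<bar>f (c 0) - f (c l)\<bar> \<le> ?I 0 l"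
  proof (rule field_le_epsilon)
    fix e :: real assume "0 < e"
    then have "e / (l + 1) * l \<le> e" using l by (simp add: field_simps)
    with approx[of "e / (l + 1)"] \<open>0 < e\<close> l show "\<bar>f (c 0) - f (c l)\<bar> \<le> ?I 0 l + e" by simp
  qed
  moreover have "c 0 = pathstart \<gamma>" "c l = pathfinish \<gamma>"
    using arc_length_param_len[of 0] arc_length_param_len[of 1]
    by (auto simp: c_def l_def pathstart_def pathfinish_def)
  moreover have "curve_integral \<gamma> (\<lambda>x. ennreal (G x)) = ennreal (?I 0 l)"
  proof -
    have "curve_integral \<gamma> (\<lambda>x. ennreal (G x)) = (\<integral>\<^sup>+s. ennreal (indicator {0..l} s * G (c s)) \<partial>lborel)"
      unfolding curve_integral_eq
      by (intro nn_integral_cong) (auto simp: indicator_def c_def l_def)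
    also have "\<dots> = ennreal (?I 0 l)"
      by (intro nn_integral_has_integral_lebesgue integrable_integral int) (auto intro!: G(2) c_X l)
    finally show ?thesis .
  qed
  ultimately show ?thesis by (simp add: ennreal_leI)
qed

end

lemma curve_length_linepath:
  fixes a b :: "'a::real_normed_vector"
  assumes "0 \<le> t"
  shows "curve_length (linepath a b) 0 t = ennreal (t * dist a b)"
proof (rule antisym)
  have d: "dist (linepath a b r) (linepath a b s) = \<bar>r - s\<bar> * dist a b" for r s
  proof -
    have "linepath a b r - linepath a b s = (r - s) *\<^sub>R (b - a)"
      by (simp add: linepath_def algebra_simps)
    then show ?thesis by (simp add: dist_norm norm_minus_commute)
  qed
  show "curve_length (linepath a b) 0 t \<le> ennreal (t * dist a b)"
  proof (rule curve_length_least)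
    fix m \<tau> assume "inscribed 0 t m \<tau>"
    then have t: "\<And>i. i \<le> m \<Longrightarrow> 0 \<le> \<tau> i \<and> \<tau> i \<le> t" "\<And>i. i < m \<Longrightarrow> \<tau> i \<le> \<tau> (Suc i)"
      by (auto simp: inscribed_def mono_on_def)
    have "polygon_length (linepath a b) m \<tau> = (\<Sum>i<m. \<tau> (Suc i) - \<tau> i) * dist a b"
      unfolding polygon_length_def sum_distrib_right using t(2) by (intro sum.cong) (auto simp: d)
    also have "\<dots> = (\<tau> m - \<tau> 0) * dist a b"
      by (simp add: sum_lessThan_telescope)
    also have "\<dots> \<le> t * dist a b"
      using t(1)[of m] t(1)[of 0] by (intro mult_right_mono) auto
    finally show "ennreal (polygon_length (linepath a b) m \<tau>) \<le> ennreal (t * dist a b)"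
      by (rule ennreal_leI)
  qed
  show "ennreal (t * dist a b) \<le> curve_length (linepath a b) 0 t"
    using dist_le_curve_length[OF assms, of "linepath a b"] assms by (simp only: d) simp
qed

text \<open>Along a segment in a unit direction the arc length parameter is the displacement, so integrals over
  a family of parallel segments become iterated Lebesgue integrals.\<close>

lemma curve_integral_linepath:
  fixes x e :: "'a::real_normed_vector"
  assumes "norm e = 1" "0 < H"
  shows "curve_integral (linepath x (x + H *\<^sub>R e)) \<rho> = (\<integral>\<^sup>+ t\<in>{0..H}. \<rho> (x + t *\<^sub>R e) \<partial>lborel)"
proof -
  let ?\<gamma> = "linepath x (x + H *\<^sub>R e)"
  have len: "curve_length ?\<gamma> 0 t = ennreal (t * H)" if "0 \<le> t" for t
    using that assms by (simp add: curve_length_linepath dist_norm)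
  have "arc_length_param ?\<gamma> s = x + s *\<^sub>R e" if s: "s \<in> {0..H}" for s
  proof -
    have "(SOME t. t \<in> {0..1} \<and> curve_length ?\<gamma> 0 t = ennreal s) = s / H"
    proof (rule some_equality)
      show "s / H \<in> {0..1} \<and> curve_length ?\<gamma> 0 (s / H) = ennreal s"
        using s assms by (simp add: len)
      fix t assume "t \<in> {0..1} \<and> curve_length ?\<gamma> 0 t = ennreal s"
      then show "t = s / H"
        using s assms by (auto simp: len field_simps)
    qed
    then show ?thesis
      using assms by (simp add: arc_length_param_def linepath_def algebra_simps)
  qed
  then show ?thesis
    unfolding curve_integral_def using assms
    by (intro nn_integral_cong) (auto simp: indicator_def len)
qed

lemma linepath_rectifiable:
  fixes a b :: "'a::real_normed_vector"
  assumes "closed_segment a b \<subseteq> X" "a \<noteq> b"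
  shows "linepath a b \<in> rectifiable_curves X"
proof -
  have "linepath a b 0 \<noteq> linepath a b 1" using assms by (simp add: linepath_def)
  then have "\<not> linepath a b constant_on {0..1}"
    unfolding constant_on_def by (metis atLeastAtMost_iff order_refl zero_le_one)
  then show ?thesis
    using assms by (simp add: rectifiable_curves_def curve_length_linepath)
qed

section \<open>Integrals and model functions in weak Lebesgue spaces\<close>

lemma ennreal_rpow_mono: "x \<le> y \<Longrightarrow> 0 \<le> a \<Longrightarrow> ennreal_rpow x a \<le> ennreal_rpow y a"
  by (auto simp: ennreal_rpow_def top_unique less_top enn2real_mono intro!: ennreal_leI powr_mono2)

lemma ennreal_rpow_ennreal: "0 \<le> x \<Longrightarrow> ennreal_rpow (ennreal x) a = ennreal (x powr a)"
  by (simp add: ennreal_rpow_def)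

lemma ennreal_rpow_eq_0_iff: "ennreal_rpow x a = 0 \<longleftrightarrow> x = 0"
  by (cases x) (auto simp: ennreal_rpow_def)

lemma emeasure_superlevel_le:
  fixes h :: "'a::euclidean_space \<Rightarrow> ennreal"
  assumes p: "0 < p" and t: "0 < t" and meas: "{x\<in>X. ennreal t < h x} \<in> sets borel"
  shows "emeasure lborel {x\<in>X. ennreal t < h x}
    \<le> ennreal (t powr (- p)) * ennreal_rpow (weak_Lp_norm p X (\<lambda>x. enn2ereal (h x))) p"
proof -
  let ?W = "weak_Lp_norm p X (\<lambda>x. enn2ereal (h x))"
  let ?m = "emeasure lborel {x\<in>X. ennreal t < h x}"
  have "{x\<in>X. ereal t < \<bar>enn2ereal (h x)\<bar>} = {x\<in>X. ennreal t < h x}"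
    using t by (auto simp: ennreal_less_iff less_ennreal.rep_eq enn2ereal_ennreal)
  then have "ennreal t * ennreal_rpow (emeasure lebesgue {x\<in>X. ennreal t < h x}) (1 / p) \<le> ?W"
    unfolding weak_Lp_norm_def using t
    by (intro SUP_upper2[where i=t]) auto
  moreover have "emeasure lebesgue {x\<in>X. ennreal t < h x} = ?m"
    using meas by simp
  ultimately have W: "ennreal t * ennreal_rpow ?m (1 / p) \<le> ?W" by simp
  show ?thesis
  proof (cases "?W")
    case top
    then show ?thesis using t by (simp add: ennreal_rpow_def ennreal_mult_top)
  next
    case (real w)
    have "?m \<noteq> top"
    proof
      assume "?m = top"
      with W real t show False by (simp add: ennreal_rpow_def ennreal_mult_top top_unique)
    qed
    then obtain m where m: "?m = ennreal m" "0 \<le> m" by (cases "?m") auto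
    with W real t have "t * m powr (1 / p) \<le> w"
      by (simp add: ennreal_rpow_ennreal flip: ennreal_mult)
    then have "(m powr (1 / p)) powr p \<le> (w / t) powr p"
      using t p by (intro powr_mono2) (auto simp: field_simps)
    then have "m \<le> t powr (- p) * w powr p"
      using m p t real by (simp add: powr_powr powr_divide powr_minus field_simps)
    then show ?thesis
      using m real by (simp add: ennreal_rpow_ennreal ennreal_leI flip: ennreal_mult)
  qed
qed

text \<open>Layer cake: \<open>\<integral>\<^sub>N h\<close> is the integral over \<open>t > 0\<close> of the measure of \<open>N \<inter> {h > t}\<close>. Below the
  threshold \<open>T\<close> this measure is at most that of \<open>N\<close>; above it, it is at most \<open>t powr (- p)\<close> times the
  \<open>p\<close>-th power of the weak norm, and \<open>t powr (- p)\<close> is integrable at infinity because \<open>p > 1\<close>. Leaving \<open>T\<close>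
  free allows the threshold to be adapted to each scale.\<close>

lemma nn_integral_weak_Lp_le:
  fixes h :: "'a::euclidean_space \<Rightarrow> ennreal"
  assumes p: "1 < p" and T: "0 < T" and h [measurable]: "h \<in> borel_measurable borel"
    and N [measurable]: "N \<in> sets borel" and zero: "\<And>x. x \<notin> X \<Longrightarrow> h x = 0"
  shows "(\<integral>\<^sup>+x\<in>N. h x \<partial>lborel) \<le> ennreal T * emeasure lborel N +
    ennreal (T powr (1 - p) / (p - 1)) * ennreal_rpow (weak_Lp_norm p X (\<lambda>x. enn2ereal (h x))) p"
proof -
  let ?W = "ennreal_rpow (weak_Lp_norm p X (\<lambda>x. enn2ereal (h x))) p"
  have h_eq: "h x = (\<integral>\<^sup>+t. indicator {t. 0 < t \<and> ennreal t < h x} t \<partial>lborel)" for x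
  proof (cases "h x")
    case (real r)
    then have "{t. 0 < t \<and> ennreal t < h x} = {0<..<r}"
      by (auto simp: ennreal_less_iff)
    then show ?thesis using real by simp
  next
    case top
    then have *: "{t. 0 < t \<and> ennreal t < h x} = {0<..}" by auto
    have "emeasure lborel {0::real<..} = top"
    proof -
      have "ennreal (real n) \<le> emeasure lborel {0::real<..}" for n :: nat
        using emeasure_mono[of "{0<..real n}" "{0::real<..}" lborel] by (simp add: subset_iff)
      then show ?thesis
        by (metis ennreal_Ex_less_of_nat ennreal_of_nat_eq_real_of_nat not_le top.not_eq_extremum)
    qed
    then show ?thesis using top * by simp
  qed
  have "(\<integral>\<^sup>+x\<in>N. h x \<partial>lborel) =
      (\<integral>\<^sup>+x. (\<integral>\<^sup>+t. indicator {t. 0 < t \<and> ennreal t < h x} t * indicator N x \<partial>lborel) \<partial>lborel)"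
    by (subst h_eq, subst nn_integral_multc) auto
  also have "\<dots> = (\<integral>\<^sup>+t. (\<integral>\<^sup>+x. indicator {t. 0 < t \<and> ennreal t < h x} t * indicator N x \<partial>lborel) \<partial>lborel)"
    by (rule lborel_pair.Fubini') measurable
  also have "\<dots> \<le> (\<integral>\<^sup>+t. (emeasure lborel N * indicator {0..T} t +
      ?W * (ennreal (t powr (- p)) * indicator {T..} t)) \<partial>lborel)"
  proof (intro nn_integral_mono)
    fix t :: real
    have "(\<integral>\<^sup>+x. indicator {t. 0 < t \<and> ennreal t < h x} t * indicator N x \<partial>lborel) =
        (\<integral>\<^sup>+x. indicator {x \<in> N. 0 < t \<and> ennreal t < h x} x \<partial>lborel)"
      by (intro nn_integral_cong) (auto simp: indicator_def)
    also have "\<dots> = emeasure lborel {x \<in> N. 0 < t \<and> ennreal t < h x}"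
      by (intro nn_integral_indicator) measurable
    also have "\<dots> \<le> emeasure lborel N * indicator {0..T} t +
      ?W * (ennreal (t powr (- p)) * indicator {T..} t)"
    proof (cases "t \<le> 0 \<or> T < t")
      case False
      then have "emeasure lborel {x \<in> N. 0 < t \<and> ennreal t < h x} \<le> emeasure lborel N * indicator {0..T} t"
        by (auto intro!: emeasure_mono)
      then show ?thesis by (simp add: add_increasing2)
    next
      case True
      show ?thesis
      proof (cases "t \<le> 0")
        case False
        with True T have t: "0 < t" "T < t" by auto
        have eq: "{x\<in>X. ennreal t < h x} = {x. ennreal t < h x}"
          using zero by fastforce
        have "emeasure lborel {x \<in> N. 0 < t \<and> ennreal t < h x} \<le> emeasure lborel {x\<in>X. ennreal t < h x}"
          unfolding eq by (intro emeasure_mono) auto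
        also have "\<dots> \<le> ennreal (t powr (- p)) * ?W"
          using p t unfolding eq[symmetric] by (intro emeasure_superlevel_le) (auto simp: eq)
        finally show ?thesis using t by (simp add: mult.commute)
      qed auto
    qed
    finally show "(\<integral>\<^sup>+x. indicator {t. 0 < t \<and> ennreal t < h x} t * indicator N x \<partial>lborel) \<le> \<dots>" .
  qed
  also have "\<dots> = emeasure lborel N * emeasure lborel {0..T} +
      ?W * (\<integral>\<^sup>+t. ennreal (t powr (- p)) * indicator {T..} t \<partial>lborel)"
    by (subst nn_integral_add) (auto simp: nn_integral_cmult)
  also have "(\<integral>\<^sup>+t. ennreal (t powr (- p)) * indicator {T..} t \<partial>lborel) =
      ennreal (0 - T powr (1 - p) / (1 - p))"
  proof (rule nn_integral_FTC_atLeast)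
    fix t assume "T \<le> t"
    then show "((\<lambda>t. t powr (1 - p) / (1 - p)) has_real_derivative t powr (- p)) (at t)"
      using T p by (auto intro!: derivative_eq_intros)
  next
    have "((\<lambda>t. t powr (1 - p)) \<longlongrightarrow> 0) at_top"
      using p by (intro tendsto_neg_powr filterlim_ident) auto
    from tendsto_divide[OF this tendsto_const, of "1 - p"] p
    show "((\<lambda>t. t powr (1 - p) / (1 - p)) \<longlongrightarrow> 0) at_top" by simp
  qed auto
  also have "0 - T powr (1 - p) / (1 - p) = T powr (1 - p) / (p - 1)"
    using p by (simp add: field_simps)
  finally show ?thesis using T by (simp add: mult.commute)
qed

text \<open>The model function of weak \<open>L\<^sup>p\<close>: the superlevel set of \<open>C * norm x powr (- n / p)\<close> at height \<open>t\<close> lies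
  in a ball whose volume is proportional to \<open>(C / t) powr p\<close>, so the resulting bound on the quantity in
  the supremum does not depend on \<open>t\<close>.\<close>

lemma weak_Lp_norm_norm_powr:
  fixes f :: "'a::euclidean_space \<Rightarrow> ereal"
  assumes p: "0 < p" and C: "0 < C"
    and f: "\<And>x. x \<in> X \<Longrightarrow> x \<noteq> 0 \<and> \<bar>f x\<bar> \<le> ereal (C * norm x powr (- real DIM('a) / p))"
  shows "weak_Lp_norm p X f < \<infinity>"
proof -
  let ?n = "real DIM('a)"
  let ?V = "unit_ball_vol ?n"
  have n: "0 < ?n" by simp
  have "weak_Lp_norm p X f \<le> ennreal (?V powr (1 / p) * C)"
    unfolding weak_Lp_norm_def
  proof (rule SUP_least)
    fix t :: real assume "t \<in> {0<..}"
    then have t: "0 < t" by simp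
    define r where "r = (C / t) powr (p / ?n)"
    have r: "0 < r" using C t by (simp add: r_def)
    have "{x\<in>X. ereal t < \<bar>f x\<bar>} \<subseteq> ball 0 r"
    proof
      fix x assume "x \<in> {x\<in>X. ereal t < \<bar>f x\<bar>}"
      with f[of x] have "x \<noteq> 0" and "ereal t < ereal (C * norm x powr (- ?n / p))"
        using order.strict_trans2 by blast+
      then have "norm x powr (?n / p) < C / t"
        using t by (simp add: powr_minus field_simps)
      then have "(norm x powr (?n / p)) powr (p / ?n) < r"
        unfolding r_def using p n by (intro powr_less_mono2) auto
      then show "x \<in> ball 0 r" using p \<open>x \<noteq> 0\<close> by (simp add: powr_powr)
    qed
    then have "emeasure lebesgue {x\<in>X. ereal t < \<bar>f x\<bar>} \<le> emeasure lebesgue (ball (0::'a) r)"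
      by (intro emeasure_mono) auto
    also have "\<dots> = ennreal (?V * r ^ DIM('a))"
      using r by (simp add: emeasure_ball)
    also have "r ^ DIM('a) = (C / t) powr p"
      using C t by (simp add: r_def powr_powr flip: powr_realpow)
    finally have "ennreal t * ennreal_rpow (emeasure lebesgue {x\<in>X. ereal t < \<bar>f x\<bar>}) (1 / p)
      \<le> ennreal t * ennreal_rpow (ennreal (?V * (C / t) powr p)) (1 / p)"
      using p by (intro mult_left_mono ennreal_rpow_mono) auto
    also have "\<dots> = ennreal (t * (?V * (C / t) powr p) powr (1 / p))"
      using t C by (simp add: ennreal_rpow_ennreal flip: ennreal_mult)
    also have "t * (?V * (C / t) powr p) powr (1 / p) = ?V powr (1 / p) * C"
      using t C p by (simp add: powr_mult powr_powr)
    finally show "ennreal t * ennreal_rpow (emeasure lebesgue {x\<in>X. ereal t < \<bar>f x\<bar>}) (1 / p)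
      \<le> ennreal (?V powr (1 / p) * C)" .
  qed
  then show ?thesis by (simp add: order_le_less_trans)
qed

section \<open>Weak upper gradients along parallel segments\<close>

text \<open>Working with a family of parallel segments, indexed by their starting points, replaces polar
  coordinates by Fubini and translation invariance.\<close>

definition flow_integral ::
    "'a::euclidean_space set \<Rightarrow> 'a \<Rightarrow> real \<Rightarrow> ('a \<Rightarrow> ennreal) \<Rightarrow> ennreal" where
  "flow_integral N e H h = (\<integral>\<^sup>+x\<in>N. (\<integral>\<^sup>+t\<in>{0..H}. h (x + t *\<^sub>R e) \<partial>lborel) \<partial>lborel)"

lemma flow_integral_le:
  fixes h :: "'a::euclidean_space \<Rightarrow> ennreal"
  assumes p: "1 < p" and T: "0 < T" and H: "0 \<le> H" and h [measurable]: "h \<in> borel_measurable borel"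
    and N [measurable]: "N \<in> sets borel" and zero: "\<And>x. x \<notin> X \<Longrightarrow> h x = 0"
  shows "flow_integral N e H h \<le> ennreal H * (ennreal T * emeasure lborel N +
    ennreal (T powr (1 - p) / (p - 1)) * ennreal_rpow (weak_Lp_norm p X (\<lambda>x. enn2ereal (h x))) p)"
    (is "_ \<le> _ * ?R")
proof -
  have shift: "(\<integral>\<^sup>+x. h (x + t *\<^sub>R e) * indicator N x \<partial>lborel) \<le> ?R" for t
  proof -
    let ?N = "(\<lambda>y. y - t *\<^sub>R e) -` N"
    have [measurable]: "?N \<in> sets borel"
      using measurable_sets[of "\<lambda>y. y - t *\<^sub>R e" borel borel N] by simp
    have translate: "(\<integral>\<^sup>+y. f y \<partial>lborel) = (\<integral>\<^sup>+x. f (t *\<^sub>R e + x) \<partial>lborel)"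
      if [measurable]: "f \<in> borel_measurable borel" for f :: "'a \<Rightarrow> ennreal"
      by (subst lborel_distr_plus[of "t *\<^sub>R e", symmetric], subst nn_integral_distr) auto
    have "(\<integral>\<^sup>+x. h (x + t *\<^sub>R e) * indicator N x \<partial>lborel) = (\<integral>\<^sup>+y\<in>?N. h y \<partial>lborel)"
      by (subst translate) (auto simp: indicator_def add.commute)
    also have "\<dots> \<le> ennreal T * emeasure lborel ?N +
      ennreal (T powr (1 - p) / (p - 1)) * ennreal_rpow (weak_Lp_norm p X (\<lambda>x. enn2ereal (h x))) p"
      by (intro nn_integral_weak_Lp_le p T zero) auto
    also have "emeasure lborel ?N = emeasure lborel N"
      using translate[of "indicator ?N"]
      by (simp add: indicator_def[abs_def] flip: nn_integral_indicator)
    finally show ?thesis .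
  qed
  have "flow_integral N e H h =
      (\<integral>\<^sup>+x. (\<integral>\<^sup>+t. h (x + t *\<^sub>R e) * indicator {0..H} t * indicator N x \<partial>lborel) \<partial>lborel)"
    unfolding flow_integral_def by (subst nn_integral_multc) auto
  also have "\<dots> = (\<integral>\<^sup>+t. (\<integral>\<^sup>+x. h (x + t *\<^sub>R e) * indicator {0..H} t * indicator N x \<partial>lborel) \<partial>lborel)"
    by (rule lborel_pair.Fubini') measurable
  also have "\<dots> \<le> (\<integral>\<^sup>+t. ?R * indicator {0..H} t \<partial>lborel)"
    by (intro nn_integral_mono) (auto simp: indicator_def intro: shift[unfolded indicator_def])
  also have "\<dots> = ennreal H * ?R"
    using H by (subst nn_integral_cmult_indicator) (simp_all add: mult.commute)
  finally show ?thesis .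
qed

text \<open>Curves in a family of zero modulus are charged at least 1 by a density whose integral over
  a family of parallel segments is as small as desired. Hence segments belonging to the exceptional
  family are negligible.\<close>

lemma exceptional_density:
  fixes X :: "'a::euclidean_space set"
  assumes p: "1 < p" and H: "0 < H" and X: "X \<in> sets borel" and \<Gamma>: "\<Gamma> \<subseteq> rectifiable_curves X"
    and mod: "weak_modulus p X \<Gamma> = 0" and N: "N \<in> sets borel" "emeasure lborel N < \<infinity>" and d: "0 < d"
  obtains \<rho> where "\<rho> \<in> borel_measurable borel" "\<And>\<gamma>. \<gamma> \<in> \<Gamma> \<Longrightarrow> 1 \<le> curve_integral \<gamma> \<rho>"
    "flow_integral N e H \<rho> \<le> ennreal d"
proof -
  obtain m where m: "0 \<le> m" "emeasure lborel N = ennreal m"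
    using N by (cases "emeasure lborel N") auto
  \<comment> \<open>this threshold makes the first term of the flow bound at most \<open>d / 2\<close>;
    the bound on the norm of \<open>\<rho>0\<close> does the same for the second\<close>
  define T where "T = d / (2 * H * (m + 1))"
  have T: "0 < T" using d H m by (simp add: T_def)
  define K where "K = T powr (1 - p) / (p - 1)"
  have K: "0 < K" using T p by (simp add: K_def)
  have "0 < d / (2 * H * K)" using d H K by simp
  then have "weak_modulus p X \<Gamma> < ennreal (d / (2 * H * K))"
    unfolding mod by simp
  then obtain \<rho>0 where \<rho>0: "\<rho>0 \<in> admissible_densities X \<Gamma>"
    "ennreal_rpow (weak_Lp_norm p X (\<lambda>x. enn2ereal (\<rho>0 x))) p < ennreal (d / (2 * H * K))"
    unfolding weak_modulus_def INF_less_iff by blast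
  define \<rho> where "\<rho> x = \<rho>0 x * indicator X x" for x
  have meas: "\<rho> \<in> borel_measurable borel"
    using \<rho>0(1) X unfolding \<rho>_def admissible_densities_def
    by (simp add: borel_measurable_restrict_space_iff_ennreal)
  have norm_eq: "weak_Lp_norm p X (\<lambda>x. enn2ereal (\<rho> x)) = weak_Lp_norm p X (\<lambda>x. enn2ereal (\<rho>0 x))"
  proof -
    have "{x \<in> X. ereal t < \<bar>enn2ereal (\<rho> x)\<bar>} = {x \<in> X. ereal t < \<bar>enn2ereal (\<rho>0 x)\<bar>}" for t
      by (auto simp: \<rho>_def)
    then show ?thesis by (simp add: weak_Lp_norm_def)
  qed
  have admissible: "1 \<le> curve_integral \<gamma> \<rho>" if "\<gamma> \<in> \<Gamma>" for \<gamma>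
  proof -
    have "\<gamma> \<in> rectifiable_curves X" using \<Gamma> that by auto
    then interpret rectifiable_curve \<gamma>
      by unfold_locales (auto simp: rectifiable_curves_def)
    have "curve_integral \<gamma> \<rho> = curve_integral \<gamma> \<rho>0"
      using \<open>\<gamma> \<in> rectifiable_curves X\<close>
      by (intro curve_integral_cong) (auto simp: \<rho>_def rectifiable_curves_def indicator_def)
    then show ?thesis using \<rho>0(1) that by (simp add: admissible_densities_def)
  qed
  have "flow_integral N e H \<rho> \<le> ennreal H * (ennreal T * ennreal m +
      ennreal K * ennreal_rpow (weak_Lp_norm p X (\<lambda>x. enn2ereal (\<rho> x))) p)"
    unfolding m(2)[symmetric] K_def
    using H by (intro flow_integral_le p T meas N) (auto simp: \<rho>_def)
  also have "\<dots> \<le> ennreal H * (ennreal T * ennreal m + ennreal K * ennreal (d / (2 * H * K)))"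
    using \<rho>0(2) by (intro mult_left_mono add_left_mono) (auto simp: norm_eq)
  also have "\<dots> = ennreal (H * (T * m + K * (d / (2 * H * K))))"
    using H T m K d by (simp flip: ennreal_mult ennreal_plus)
  also have "\<dots> \<le> ennreal d"
  proof (rule ennreal_leI)
    have "H * (T * m + K * (d / (2 * H * K))) = d / 2 * (m / (m + 1)) + d / 2"
    proof -
      have "H * (T * m) = d / 2 * (m / (m + 1))" "H * (K * (d / (2 * H * K))) = d / 2"
        using H K by (simp_all add: T_def)
      then show ?thesis by (simp only: distrib_left)
    qed
    also have "\<dots> \<le> d / 2 * 1 + d / 2"
      using d m by (intro add_right_mono mult_left_mono) auto
    finally show "H * (T * m + K * (d / (2 * H * K))) \<le> d" by simp
  qed
  finally show ?thesis using that meas admissible by blast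
qed

text \<open>If \<open>f\<close> jumps by at least \<open>\<kappa>\<close> between the ends of almost every segment, then a weak upper gradient has
  integral at least \<open>\<kappa>\<close> along those that are not exceptional. On a segment in the exceptional family, \<open>\<kappa> * \<rho>\<close> does
  so instead, with \<open>\<rho>\<close> from the previous lemma; adding the two densities avoids discussing whether the
  set of exceptional starting points is measurable.\<close>

lemma weak_upper_gradient_flow_integral:
  fixes X :: "'a::euclidean_space set"
  assumes p: "1 < p" and e: "norm e = 1" and H: "0 < H" and X: "X \<in> sets borel"
    and N [measurable]: "N \<in> sets borel" and fin: "emeasure lborel N < \<infinity>"
    and segments: "\<And>x. x \<in> N \<Longrightarrow> closed_segment x (x + H *\<^sub>R e) \<subseteq> X"
    and g: "weak_upper_gradient p X f g" and \<kappa>: "0 < \<kappa>"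
    and gap: "AE x in lborel. x \<in> N \<longrightarrow> \<bar>f x\<bar> \<noteq> \<infinity> \<and> \<bar>f (x + H *\<^sub>R e)\<bar> \<noteq> \<infinity> \<and>
      ereal \<kappa> \<le> \<bar>f x - f (x + H *\<^sub>R e)\<bar>"
  shows "ennreal \<kappa> * emeasure lborel N \<le> flow_integral N e H (\<lambda>x. g x * indicator X x)"
proof (rule ennreal_le_epsilon)
  fix d :: real assume d: "0 < d"
  obtain \<Gamma> where \<Gamma>: "\<Gamma> \<subseteq> rectifiable_curves X" "weak_modulus p X \<Gamma> = 0"
    and ug: "\<And>\<gamma>. \<gamma> \<in> rectifiable_curves X - \<Gamma> \<Longrightarrow>
      (if \<bar>f (pathstart \<gamma>)\<bar> \<noteq> \<infinity> \<and> \<bar>f (pathfinish \<gamma>)\<bar> \<noteq> \<infinity>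
       then \<bar>f (pathstart \<gamma>) - f (pathfinish \<gamma>)\<bar> \<le> enn2ereal (curve_integral \<gamma> g)
       else curve_integral \<gamma> g = \<infinity>)"
    using g unfolding weak_upper_gradient_def almost_every_curve_def by blast
  have [measurable]: "(\<lambda>x. g x * indicator X x) \<in> borel_measurable borel"
    using g X by (simp add: weak_upper_gradient_def borel_measurable_restrict_space_iff_ennreal)
  obtain \<rho> where \<rho> [measurable]: "\<rho> \<in> borel_measurable borel"
    and adm: "\<And>\<gamma>. \<gamma> \<in> \<Gamma> \<Longrightarrow> 1 \<le> curve_integral \<gamma> \<rho>"
    and small: "flow_integral N e H \<rho> \<le> ennreal (d / \<kappa>)"
    using exceptional_density[OF p H X \<Gamma> N fin, of "d / \<kappa>" e] d \<kappa> by auto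
  let ?I = "\<lambda>h x. \<integral>\<^sup>+t\<in>{0..H}. h (x + t *\<^sub>R e) \<partial>lborel"
  let ?g = "\<lambda>x. g x * indicator X x"
  have "ennreal \<kappa> * emeasure lborel N = (\<integral>\<^sup>+x\<in>N. ennreal \<kappa> \<partial>lborel)"
    by (simp add: nn_integral_cmult_indicator)
  also have "\<dots> \<le> (\<integral>\<^sup>+x\<in>N. (?I ?g x + ennreal \<kappa> * ?I \<rho> x) \<partial>lborel)"
  proof (intro nn_integral_mono_AE, use gap in eventually_elim)
    fix x assume x: "x \<in> N \<longrightarrow> \<bar>f x\<bar> \<noteq> \<infinity> \<and> \<bar>f (x + H *\<^sub>R e)\<bar> \<noteq> \<infinity> \<and>
      ereal \<kappa> \<le> \<bar>f x - f (x + H *\<^sub>R e)\<bar>"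
    show "ennreal \<kappa> * indicator N x \<le> (?I ?g x + ennreal \<kappa> * ?I \<rho> x) * indicator N x"
    proof (cases "x \<in> N")
      case True
      let ?\<gamma> = "linepath x (x + H *\<^sub>R e)"
      have rect: "?\<gamma> \<in> rectifiable_curves X"
        using True segments e H by (intro linepath_rectifiable) auto
      show ?thesis
      proof (cases "?\<gamma> \<in> \<Gamma>")
        case \<Gamma>: True
        have "ennreal \<kappa> * 1 \<le> ennreal \<kappa> * ?I \<rho> x"
          using adm[OF \<Gamma>] e H by (intro mult_left_mono) (auto simp: curve_integral_linepath)
        then show ?thesis using True by (simp add: add_increasing)
      next
        case False
        interpret rectifiable_curve ?\<gamma>
          using rect by unfold_locales (auto simp: rectifiable_curves_def)
        have "ereal \<kappa> \<le> enn2ereal (curve_integral ?\<gamma> g)"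
          using ug[of ?\<gamma>] rect False x True by (auto intro: order_trans)
        then have "ennreal \<kappa> \<le> curve_integral ?\<gamma> g"
          using \<kappa> by (simp add: less_eq_ennreal.rep_eq enn2ereal_ennreal)
        also have "curve_integral ?\<gamma> g = curve_integral ?\<gamma> ?g"
          using rect by (intro curve_integral_cong) (auto simp: rectifiable_curves_def indicator_def)
        also have "\<dots> = ?I ?g x"
          using e H by (rule curve_integral_linepath)
        finally show ?thesis using True by (simp add: add_increasing2)
      qed
    qed simp
  qed
  also have "\<dots> = (\<integral>\<^sup>+x. (?I ?g x * indicator N x + ennreal \<kappa> * (?I \<rho> x * indicator N x)) \<partial>lborel)"
    by (simp add: distrib_right mult.assoc)
  also have "\<dots> = flow_integral N e H ?g + ennreal \<kappa> * flow_integral N e H \<rho>"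
    unfolding flow_integral_def by (subst nn_integral_add) (auto simp: nn_integral_cmult)
  also have "\<dots> \<le> flow_integral N e H ?g + ennreal \<kappa> * ennreal (d / \<kappa>)"
    by (intro add_left_mono mult_left_mono small) auto
  also have "ennreal \<kappa> * ennreal (d / \<kappa>) = ennreal d"
    using \<kappa> d by (simp flip: ennreal_mult)
  finally show "ennreal \<kappa> * emeasure lborel N \<le> flow_integral N e H ?g + ennreal d" .
qed

text \<open>Only the function part of the Newtonian norm is used, so equivalent functions agree almost everywhere.
  This is enough to treat arbitrary representatives, since the lower bound below tests the functions
  only at almost every endpoint.\<close>

lemma newtonian_rel_AE_eq:
  fixes X :: "'a::euclidean_space set"
  assumes X: "X \<in> sets borel" and rel: "(u, v) \<in> newtonian_rel p X"
    and fin: "\<And>x. x \<in> X \<Longrightarrow> \<bar>u x\<bar> \<noteq> \<infinity>"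
  shows "AE x in lborel. x \<in> X \<longrightarrow> v x = u x"
proof -
  have "newtonian_norm p X (\<lambda>x. u x - v x) = 0"
    and [measurable]: "u \<in> borel_measurable (restrict_space borel X)" "v \<in> borel_measurable (restrict_space borel X)"
    using rel by (auto simp: newtonian_rel_def newtonian_functions_def)
  then have zero: "weak_Lp_norm p X (\<lambda>x. u x - v x) = 0"
    by (simp add: newtonian_norm_def ennreal_rpow_eq_0_iff)
  define S where "S n = {x\<in>X. ereal (inverse (real (Suc n))) < \<bar>u x - v x\<bar>}" for n
  have S_sets: "S n \<in> sets borel" for n
  proof -
    have "{x \<in> space (restrict_space borel X). ereal (inverse (real (Suc n))) < \<bar>u x - v x\<bar>}
        \<in> sets (restrict_space borel X)" by measurable
    then show ?thesis
      using X by (auto simp: S_def space_restrict_space sets_restrict_space_iff)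
  qed
  have "AE x in lborel. x \<notin> S n" for n
  proof -
    have "ennreal (inverse (real (Suc n))) * ennreal_rpow (emeasure lebesgue (S n)) (1 / p) \<le> 0"
      unfolding zero[symmetric] weak_Lp_norm_def S_def by (rule SUP_upper) simp
    then have "emeasure lebesgue (S n) = 0"
      by (simp add: ennreal_rpow_eq_0_iff del: of_nat_Suc)
    then show ?thesis
      using S_sets by (intro AE_not_in) (simp add: null_sets_def)
  qed
  then have "AE x in lborel. \<forall>n. x \<notin> S n" by (simp add: AE_all_countable)
  then show ?thesis
  proof eventually_elim
    case (elim x)
    show ?case
    proof (intro impI, rule ccontr)
      assume x: "x \<in> X" and ne: "v x \<noteq> u x"
      have "0 < \<bar>u x - v x\<bar>"
        using fin[OF x] ne by (cases "u x"; cases "v x") auto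
      then obtain n where "ereal (inverse (real (Suc n))) < \<bar>u x - v x\<bar>"
        using reals_Archimedean by (cases "\<bar>u x - v x\<bar>") auto
      then show False using elim x by (auto simp: S_def)
    qed
  qed
qed

section \<open>The radial profile and membership in the Newtonian space\<close>

text \<open>The function \<open>u\<close> of the theorem as a function of the distance from the origin, with real \<open>n\<close>.\<close>

definition profile :: "real \<Rightarrow> real \<Rightarrow> real \<Rightarrow> real" where
  "profile n p r = (if p < n then r powr (1 - n / p) - 1 else ln (1 / r))"

context
  fixes n p :: real
  assumes p: "1 < p" "p \<le> n"
begin

text \<open>The derivative is \<open>1 - n / p\<close> or \<open>- 1\<close> times \<open>r powr (- n / p)\<close>; the constant \<open>n / p\<close> dominates both
  cases at once.\<close>

lemma profile_deriv:
  assumes "0 < r"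
  obtains D where "(profile n p has_real_derivative D) (at r)" "\<bar>D\<bar> \<le> n / p * r powr (- n / p)"
proof (cases "p < n")
  case True
  then have "profile n p = (\<lambda>r. r powr (1 - n / p) - 1)"
    by (auto simp: profile_def)
  moreover have "((\<lambda>r. r powr (1 - n / p) - 1) has_real_derivative (1 - n / p) * r powr (1 - n / p - 1)) (at r)"
    using assms by (auto intro!: derivative_eq_intros)
  moreover have "\<bar>(1 - n / p) * r powr (1 - n / p - 1)\<bar> \<le> n / p * r powr (- n / p)"
  proof -
    have "\<bar>1 - n / p\<bar> \<le> n / p" using p by (simp add: abs_if)
    then show ?thesis unfolding abs_mult by (intro mult_mono) auto
  qed
  ultimately show ?thesis using that by metis
next
  case False
  with p have "n = p" by simp
  then have "profile n p = (\<lambda>r. ln (1 / r))"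
    by (auto simp: profile_def)
  moreover have "((\<lambda>r. ln (1 / r)) has_real_derivative - (1 / r)) (at r)"
    using assms by (auto intro!: derivative_eq_intros simp: field_simps power2_eq_square)
  moreover have "\<bar>- (1 / r)\<bar> \<le> n / p * r powr (- n / p)"
    using p \<open>n = p\<close> assms by (simp add: powr_minus field_simps)
  ultimately show ?thesis using that by metis
qed

lemma profile_antimono: "0 < r \<Longrightarrow> r \<le> s \<Longrightarrow> profile n p s \<le> profile n p r"
  using p by (auto simp: profile_def ln_div intro!: powr_mono2')

lemma profile_nonneg: "0 < r \<Longrightarrow> r \<le> 1 \<Longrightarrow> 0 \<le> profile n p r"
  using profile_antimono[of r 1] by (simp add: profile_def split: if_splits)

lemma profile_le:
  assumes "0 < r" "r \<le> 1"
  shows "profile n p r \<le> r powr (- n / p)"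
proof (cases "p < n")
  case True
  have "r powr (1 - n / p) \<le> r powr (- n / p)"
    using assms by (intro powr_mono') auto
  then show ?thesis using True by (simp add: profile_def)
next
  case False
  have "ln (1 / r) \<le> 1 / r" using assms by (intro ln_bound) auto
  then show ?thesis using False p assms by (simp add: profile_def powr_minus field_simps)
qed

text \<open>Scale invariance, the reason for the choice of exponent: oscillation over an annulus of radius \<open>s\<close>
  scales exactly like \<open>s\<close> times the critical gradient \<open>s powr (- n / p)\<close>.\<close>

lemma profile_scale:
  assumes "0 < s" "0 < a" "0 < b"
  shows "profile n p (a * s) - profile n p (b * s) = (profile n p a - profile n p b) * s powr (1 - n / p)"
proof (cases "p < n")
  case False
  then have "n = p" using p by simp
  then show ?thesis using assms p by (simp add: profile_def ln_div ln_mult)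
qed (use assms in \<open>simp add: profile_def powr_mult algebra_simps\<close>)

lemma profile_3_5: "profile n p 5 < profile n p 3"
  using p by (auto simp: profile_def ln_div intro!: powr_less_mono2_neg)

lemma profile_unbounded:
  assumes "0 \<le> k"
  obtains r where "0 < r" "k \<le> profile n p r"
proof (cases "p < n")
  case True
  then have "((k + 1) powr (1 / (1 - n / p))) powr (1 - n / p) = k + 1"
    using p assms by (simp add: powr_powr)
  then show ?thesis
    using True assms by (intro that[of "(k + 1) powr (1 / (1 - n / p))"]) (auto simp: profile_def)
next
  case False
  then show ?thesis by (intro that[of "exp (- k)"]) (auto simp: profile_def ln_div)
qed

lemma profile_norm_local_Lipschitz:
  fixes x :: "'a::real_normed_vector"
  assumes x: "x \<noteq> 0" and e: "0 < e"
  shows "\<exists>d>0. \<forall>y\<in>ball x d. \<forall>z\<in>ball x d.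
    \<bar>profile n p (norm y) - profile n p (norm z)\<bar> \<le> (n / p * norm x powr (- n / p) + e) * dist y z"
proof -
  let ?G = "\<lambda>r. n / p * r powr (- n / p)"
  have "isCont ?G (norm x)"
    using x by (intro continuous_intros) auto
  then obtain d0 where d0: "d0 > 0" "\<And>r. dist r (norm x) < d0 \<Longrightarrow> dist (?G r) (?G (norm x)) < e"
    using e unfolding continuous_at_eps_delta dist_real_def by metis
  define d where "d = min d0 (norm x)"
  show ?thesis
  proof (intro exI[of _ d] conjI ballI)
    show "0 < d" using d0 x by (simp add: d_def)
    fix y z assume yz: "y \<in> ball x d" "z \<in> ball x d"
    have near: "norm w \<in> ball (norm x) d" if "w \<in> ball x d" for w
      using that norm_triangle_ineq3[of x w] by (simp add: dist_norm)
    obtain D where D: "\<And>r. 0 < r \<Longrightarrow> (profile n p has_real_derivative D r) (at r)"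
        "\<And>r. 0 < r \<Longrightarrow> \<bar>D r\<bar> \<le> ?G r"
    proof -
      have "\<forall>r. \<exists>D. 0 < r \<longrightarrow> (profile n p has_real_derivative D) (at r) \<and> \<bar>D\<bar> \<le> ?G r"
        using profile_deriv by blast
      then show ?thesis using that by metis
    qed
    have "norm (profile n p (norm y) - profile n p (norm z)) \<le> (?G (norm x) + e) * norm (norm y - norm z)"
    proof (rule field_differentiable_bound[where f' = D])
      fix r assume r: "r \<in> ball (norm x) d"
      then have "0 < r" "dist r (norm x) < d0" by (auto simp: d_def dist_real_def)
      show "(profile n p has_real_derivative D r) (at r within ball (norm x) d)"
        by (rule has_field_derivative_at_within[OF D(1)[OF \<open>0 < r\<close>]])
      show "norm (D r) \<le> ?G (norm x) + e"
      proof -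
        have "?G r < ?G (norm x) + e"
          using d0(2)[OF \<open>dist r (norm x) < d0\<close>] unfolding dist_real_def abs_diff_less_iff by blast
        with D(2)[OF \<open>0 < r\<close>] show ?thesis
          unfolding real_norm_def by (meson less_imp_le order_trans)
      qed
    qed (use near yz in auto)
    also have "\<dots> \<le> (?G (norm x) + e) * dist y z"
      using p e norm_triangle_ineq3[of y z]
      by (intro mult_left_mono) (auto simp: dist_norm)
    finally show "\<bar>profile n p (norm y) - profile n p (norm z)\<bar> \<le> (?G (norm x) + e) * dist y z" by simp
  qed
qed

end

lemma almost_every_curveI:
  assumes "\<And>\<gamma>. \<gamma> \<in> rectifiable_curves X \<Longrightarrow> P \<gamma>"
  shows "almost_every_curve p X P"
proof -
  have "(\<lambda>_. 0) \<in> admissible_densities X {}"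
    by (simp add: admissible_densities_def)
  moreover have "weak_Lp_norm p X (\<lambda>x. enn2ereal 0) = 0"
  proof -
    have "weak_Lp_norm p X (\<lambda>x. enn2ereal 0) \<le> 0"
      unfolding weak_Lp_norm_def by (rule SUP_least) (simp add: zero_ennreal.rep_eq ennreal_rpow_def)
    then show ?thesis by simp
  qed
  ultimately have "weak_modulus p X {} \<le> ennreal_rpow 0 p"
    unfolding weak_modulus_def by (intro INF_lower2[where i="\<lambda>_. 0"]) simp_all
  then have "weak_modulus p X {} = 0"
    by (simp add: ennreal_rpow_eq_0_iff[THEN iffD2])
  with assms show ?thesis
    unfolding almost_every_curve_def by blast
qed

text \<open>The density \<open>n / p * norm x powr (- n / p)\<close> lies in weak \<open>L\<^sup>p\<close> and is an upper gradient of \<open>u\<close> along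
  every curve in the punctured ball. Stated for Lipschitz bounds, which survive truncation, the lemma
  serves the function of the theorem and all its truncations.\<close>

lemma newtonian_functionsI:
  fixes f :: "'a::euclidean_space \<Rightarrow> real" and u :: "'a \<Rightarrow> ereal"
  assumes p: "1 < p" "p \<le> real DIM('a)" and X: "X = ball 0 1 - {0}"
    and u: "\<And>x. x \<in> X \<Longrightarrow> u x = ereal (f x)" and cont: "continuous_on X f"
    and bound: "\<And>x. x \<in> X \<Longrightarrow> \<bar>f x\<bar> \<le> norm x powr (- real DIM('a) / p)"
    and Lip: "\<And>x e. x \<in> X \<Longrightarrow> 0 < e \<Longrightarrow> \<exists>d>0. \<forall>y\<in>X \<inter> ball x d. \<forall>z\<in>X \<inter> ball x d.
      \<bar>f y - f z\<bar> \<le> (real DIM('a) / p * norm x powr (- real DIM('a) / p) + e) * dist y z"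
  shows "u \<in> newtonian_functions p X"
proof -
  let ?G = "\<lambda>x::'a. real DIM('a) / p * norm x powr (- real DIM('a) / p)"
  have X_sets: "X \<in> sets borel" unfolding X by measurable
  have meas: "u \<in> borel_measurable (restrict_space borel X)"
  proof -
    have "(\<lambda>x. ereal (f x)) \<in> borel_measurable (restrict_space borel X)"
      using borel_measurable_continuous_on_restrict[OF cont] by measurable
    then show ?thesis
      by (rule measurable_cong[THEN iffD2, rotated]) (simp add: u space_restrict_space)
  qed
  have to_lebesgue: "h \<in> borel_measurable (lebesgue_on X)" if "h \<in> borel_measurable (restrict_space borel X)"
    for h :: "'a \<Rightarrow> ereal"
  proof (rule measurableI)
    fix A :: "ereal set" assume "A \<in> sets borel"
    then have "h -` A \<inter> space (restrict_space borel X) \<in> sets (restrict_space borel X)"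
      using that by (rule measurable_sets[rotated])
    then have "h -` A \<inter> X \<in> sets borel" "h -` A \<inter> X \<subseteq> X"
      using X_sets by (auto simp: space_restrict_space sets_restrict_space_iff)
    then show "h -` A \<inter> space (lebesgue_on X) \<in> sets (lebesgue_on X)"
      using X_sets by (auto simp: space_restrict_space sets_restrict_space_iff)
  qed simp
  have "weak_Lp_norm p X u < \<infinity>"
    using p bound by (intro weak_Lp_norm_norm_powr[where C=1]) (auto simp: X u)
  then have "u \<in> weak_Lp p X"
    using to_lebesgue[OF meas] by (simp add: weak_Lp_def)
  moreover have "(\<lambda>x. ennreal (?G x)) \<in> Lp_weak_upper_gradients p X u"
  proof -
    have cont_G: "continuous_on X ?G"
      by (intro continuous_intros) (auto simp: X)
    have [measurable]: "?G \<in> borel_measurable (restrict_space borel X)"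
      by (rule borel_measurable_continuous_on_restrict[OF cont_G])
    have G_meas: "(\<lambda>x. ennreal (?G x)) \<in> borel_measurable (restrict_space borel X)"
      by measurable
    have "weak_Lp_norm p X (\<lambda>x. enn2ereal (ennreal (?G x))) < \<infinity>"
      using p by (intro weak_Lp_norm_norm_powr[where C="real DIM('a) / p"]) (auto simp: X enn2ereal_ennreal)
    moreover have "(\<lambda>x. enn2ereal (ennreal (?G x))) \<in> borel_measurable (restrict_space borel X)"
      using G_meas by measurable
    then have "(\<lambda>x. enn2ereal (ennreal (?G x))) \<in> borel_measurable (lebesgue_on X)"
      by (rule to_lebesgue)
    moreover have "weak_upper_gradient p X u (\<lambda>x. ennreal (?G x))"
      unfolding weak_upper_gradient_def
    proof (intro conjI G_meas almost_every_curveI)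
      fix \<gamma> assume \<gamma>: "\<gamma> \<in> rectifiable_curves X"
      then interpret rectifiable_curve \<gamma>
        by unfold_locales (auto simp: rectifiable_curves_def)
      have im: "path_image \<gamma> \<subseteq> X" using \<gamma> by (simp add: rectifiable_curves_def)
      then have ends: "pathstart \<gamma> \<in> X" "pathfinish \<gamma> \<in> X" by auto
      have "ennreal \<bar>f (pathstart \<gamma>) - f (pathfinish \<gamma>)\<bar> \<le> curve_integral \<gamma> (\<lambda>x. ennreal (?G x))"
        using p by (intro increment_le_curve_integral[OF im cont_G _ Lip]) auto
      then show "if \<bar>u (pathstart \<gamma>)\<bar> \<noteq> \<infinity> \<and> \<bar>u (pathfinish \<gamma>)\<bar> \<noteq> \<infinity>
        then \<bar>u (pathstart \<gamma>) - u (pathfinish \<gamma>)\<bar> \<le> enn2ereal (curve_integral \<gamma> (\<lambda>x. ennreal (?G x)))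
        else curve_integral \<gamma> (\<lambda>x. ennreal (?G x)) = \<infinity>"
        by (simp add: u ends less_eq_ennreal.rep_eq enn2ereal_ennreal)
    qed
    ultimately show ?thesis
      unfolding Lp_weak_upper_gradients_def weak_Lp_def by blast
  qed
  ultimately show ?thesis
    using meas unfolding newtonian_functions_def by blast
qed

section \<open>Truncations stay at a fixed distance\<close>

text \<open>The heart of the matter: the weak norm of every gradient of \<open>min u k - u\<close>, where
  \<open>u x = profile n p (norm x)\<close>, is bounded below by a constant in which \<open>k\<close> does not occur. At
  a scale \<open>s\<close> so small that \<open>u \<ge> k\<close> on the ball of radius \<open>7 * s\<close>, consider the segments of length \<open>4 * s\<close> that start in a ball of radius \<open>s\<close> about a point at
  distance \<open>2 * s\<close> and point away from the origin. They start inside radius \<open>3 * s\<close> and end outside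
  radius \<open>5 * s\<close>, so \<open>u\<close> drops by at least \<open>\<kappa> * s powr (1 - n / p)\<close> along each of them. Comparing with the
  upper bound for flow integrals, all powers of \<open>s\<close> cancel.\<close>

lemma weak_upper_gradient_lower_bound:
  fixes d :: "'a::euclidean_space \<Rightarrow> ereal" and p :: real
  defines "n \<equiv> real DIM('a)"
  defines "\<kappa> \<equiv> profile n p 3 - profile n p 5"
  assumes p: "1 < p" "p \<le> n" and X: "X = ball 0 1 - {0}" and k: "0 \<le> k"
    and d: "AE x in lborel. x \<in> X \<longrightarrow> d x = ereal (min (profile n p (norm x)) k - profile n p (norm x))"
    and g: "weak_upper_gradient p X d g"
  shows "ennreal (\<kappa> * unit_ball_vol n * (p - 1) / (8 * (\<kappa> / 8) powr (1 - p)))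
    \<le> ennreal_rpow (weak_Lp_norm p X (\<lambda>x. enn2ereal (g x))) p"
    (is "ennreal ?c \<le> ennreal_rpow ?W p")
proof (cases "?W")
  case top
  then show ?thesis by (simp add: ennreal_rpow_def)
next
  case (real w)
  let ?\<phi> = "profile n p"
  let ?V = "unit_ball_vol n"
  have \<kappa>: "0 < \<kappa>" using profile_3_5[OF p] by (simp add: \<kappa>_def)
  have X_sets: "X \<in> sets borel" unfolding X by measurable
  obtain e :: 'a where e: "norm e = 1" using norm_Basis nonempty_Basis by blast
  obtain r where r: "0 < r" "k \<le> ?\<phi> r" using profile_unbounded[OF p k] .
  \<comment> \<open>\<open>7 * s\<close> is below both the radius where \<open>u \<ge> k\<close> and the radius of the unit ball\<close>
  define s where "s = min r (1 / 2) / 7"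
  have s: "0 < s" "7 * s \<le> r" "7 * s < 1" using r by (auto simp: s_def)
  have k_le: "k \<le> ?\<phi> \<rho>" if "0 < \<rho>" "\<rho> \<le> 7 * s" for \<rho>
    using profile_antimono[OF p, of \<rho> r] that s r by simp
  define N where "N = ball ((2 * s) *\<^sub>R e) s"
  define H where "H = 4 * s"
  have norms: "s + t < norm (x + t *\<^sub>R e)" "norm (x + t *\<^sub>R e) < 3 * s + t" if "x \<in> N" "0 \<le> t" for x t
  proof -
    have "norm ((x + t *\<^sub>R e) - (2 * s + t) *\<^sub>R e) < s"
      using that by (simp add: N_def dist_norm norm_minus_commute algebra_simps)
    moreover have "norm ((2 * s + t) *\<^sub>R e) = 2 * s + t" using e s that by simp
    ultimately show "s + t < norm (x + t *\<^sub>R e)" "norm (x + t *\<^sub>R e) < 3 * s + t"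
      using norm_triangle_ineq3[of "x + t *\<^sub>R e" "(2 * s + t) *\<^sub>R e"] by linarith+
  qed
  have in_X: "x + t *\<^sub>R e \<in> X" if "x \<in> N" "0 \<le> t" "t \<le> H" for x t
    using norms[OF that(1,2)] that s by (auto simp: X H_def)
  have segments: "closed_segment x (x + H *\<^sub>R e) \<subseteq> X" if "x \<in> N" for x
  proof
    fix z assume "z \<in> closed_segment x (x + H *\<^sub>R e)"
    then obtain u where "0 \<le> u" "u \<le> 1" "z = x + (u * H) *\<^sub>R e"
      by (auto simp: in_segment algebra_simps)
    then show "z \<in> X" using in_X[OF that, of "u * H"] s by (simp add: H_def mult_left_le_one_le)
  qed
  define K where "K = \<kappa> * s powr (1 - n / p)"
  have K: "0 < K" using \<kappa> s by (simp add: K_def)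
  have "AE x in distr lborel borel ((+) (H *\<^sub>R e)).
      x \<in> X \<longrightarrow> d x = ereal (min (?\<phi> (norm x)) k - ?\<phi> (norm x))"
    unfolding lborel_distr_plus by (rule d)
  then have "AE x in lborel. H *\<^sub>R e + x \<in> X \<longrightarrow>
      d (H *\<^sub>R e + x) = ereal (min (?\<phi> (norm (H *\<^sub>R e + x))) k - ?\<phi> (norm (H *\<^sub>R e + x)))"
    by (rule AE_distrD[rotated]) simp
  with d have gap: "AE x in lborel. x \<in> N \<longrightarrow> \<bar>d x\<bar> \<noteq> \<infinity> \<and> \<bar>d (x + H *\<^sub>R e)\<bar> \<noteq> \<infinity> \<and>
      ereal K \<le> \<bar>d x - d (x + H *\<^sub>R e)\<bar>"
  proof eventually_elim
    case (elim x)
    show ?case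
    proof
      assume x: "x \<in> N"
      let ?y = "x + H *\<^sub>R e"
      have nx: "s < norm x" "norm x < 3 * s" using norms[OF x, of 0] by auto
      have ny: "5 * s < norm ?y" "norm ?y < 7 * s" using norms[OF x, of H] s by (auto simp: H_def)
      have "k \<le> ?\<phi> (norm x)" "k \<le> ?\<phi> (norm ?y)"
        using nx ny s by (auto intro!: k_le)
      then have "d x = ereal (k - ?\<phi> (norm x))" "d ?y = ereal (k - ?\<phi> (norm ?y))"
        using elim in_X[OF x, of 0] in_X[OF x, of H] s
        by (simp_all add: H_def add.commute min_absorb2)
      moreover have "K \<le> ?\<phi> (norm x) - ?\<phi> (norm ?y)"
      proof -
        have "?\<phi> (3 * s) \<le> ?\<phi> (norm x)" "?\<phi> (norm ?y) \<le> ?\<phi> (5 * s)"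
          using nx ny s by (auto intro!: profile_antimono[OF p])
        moreover have "?\<phi> (3 * s) - ?\<phi> (5 * s) = K"
          using s unfolding K_def \<kappa>_def by (intro profile_scale[OF p]) auto
        ultimately show ?thesis by linarith
      qed
      ultimately show "\<bar>d x\<bar> \<noteq> \<infinity> \<and> \<bar>d ?y\<bar> \<noteq> \<infinity> \<and> ereal K \<le> \<bar>d x - d ?y\<bar>" by simp
    qed
  qed
  have N: "emeasure lborel N = ennreal (?V * s powr n)"
    using s unfolding N_def n_def by (simp add: emeasure_ball powr_realpow)
  define g' where "g' x = g x * indicator X x" for x
  have g'_meas: "g' \<in> borel_measurable borel"
    using g X_sets unfolding g'_def weak_upper_gradient_def
    by (simp add: borel_measurable_restrict_space_iff_ennreal)
  have W': "weak_Lp_norm p X (\<lambda>x. enn2ereal (g' x)) = ennreal w"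
  proof -
    have "{x \<in> X. ereal t < \<bar>enn2ereal (g' x)\<bar>} = {x \<in> X. ereal t < \<bar>enn2ereal (g x)\<bar>}" for t
      by (auto simp: g'_def)
    then show ?thesis using real by (simp add: weak_Lp_norm_def)
  qed
  \<comment> \<open>the factor 1/8 lets the bounded part of the flow integral absorb at most half of the left-hand side\<close>
  define T where "T = \<kappa> / 8 * s powr (- n / p)"
  have T: "0 < T" using \<kappa> s by (simp add: T_def)
  have "ennreal K * emeasure lborel N \<le> flow_integral N e H g'"
    unfolding g'_def
    by (rule weak_upper_gradient_flow_integral[OF p(1) e _ X_sets _ _ segments g K gap])
      (use s N in \<open>simp_all add: H_def N_def\<close>)
  also have "\<dots> \<le> ennreal H * (ennreal T * emeasure lborel N +
      ennreal (T powr (1 - p) / (p - 1)) * ennreal_rpow (weak_Lp_norm p X (\<lambda>x. enn2ereal (g' x))) p)"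
    by (rule flow_integral_le[OF p(1) T _ g'_meas]) (use s in \<open>simp_all add: H_def N_def g'_def\<close>)
  finally have "ennreal (K * (?V * s powr n)) \<le>
      ennreal (H * (T * (?V * s powr n) + T powr (1 - p) / (p - 1) * w powr p))"
    using K T real p s
    by (simp add: N W' ennreal_rpow_ennreal H_def n_def flip: ennreal_mult ennreal_plus)
  then have main: "K * (?V * s powr n) \<le> H * (T * (?V * s powr n) + T powr (1 - p) / (p - 1) * w powr p)"
    using p T s by (subst (asm) ennreal_le_iff) (auto simp: H_def n_def intro!: mult_nonneg_nonneg add_nonneg_nonneg)
  define \<sigma> where "\<sigma> = s powr (1 - n / p + n)"
  have \<sigma>: "0 < \<sigma>" using s by (simp add: \<sigma>_def)
  have eq1: "K * (?V * s powr n) = \<kappa> * ?V * \<sigma>"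
    by (simp add: K_def \<sigma>_def powr_add)
  have eq2: "H * (T * (?V * s powr n)) = \<kappa> / 2 * ?V * \<sigma>"
  proof -
    have "\<sigma> = s * s powr (- n / p) * s powr n"
      using s by (simp add: \<sigma>_def flip: powr_add powr_one_gt_zero_iff) (simp add: powr_add powr_diff powr_minus field_simps)
    then show ?thesis by (simp add: H_def T_def)
  qed
  have eq3: "H * (T powr (1 - p) / (p - 1) * w powr p) = 4 * (\<kappa> / 8) powr (1 - p) / (p - 1) * w powr p * \<sigma>"
  proof -
    have "T powr (1 - p) = (\<kappa> / 8) powr (1 - p) * s powr (- n / p + n)"
    proof -
      have "- n / p * (1 - p) = - n / p + n" using p by (simp add: field_simps)
      then show ?thesis unfolding T_def using \<kappa> s by (simp only: powr_mult powr_powr)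
    qed
    moreover have "\<sigma> = s * s powr (- n / p + n)"
      using s by (simp add: \<sigma>_def powr_add powr_diff powr_minus field_simps)
    ultimately show ?thesis by (simp add: H_def)
  qed
  have "\<kappa> * ?V * \<sigma> \<le> (\<kappa> / 2 * ?V + 4 * (\<kappa> / 8) powr (1 - p) / (p - 1) * w powr p) * \<sigma>"
    using main by (simp only: distrib_left distrib_right eq1 eq2 eq3)
  then have "\<kappa> * ?V / 2 \<le> 4 * (\<kappa> / 8) powr (1 - p) / (p - 1) * w powr p"
    using \<sigma> by simp
  then have "?c \<le> w powr p"
    using \<kappa> p by (simp add: field_simps)
  then show ?thesis
    using real by (simp add: ennreal_rpow_ennreal ennreal_leI)
qed

lemma newtonian_class_in_space: "u \<in> newtonian_functions p X \<Longrightarrow> newtonian_class p X u \<in> newtonian_space p X"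
  unfolding newtonian_class_def newtonian_space_def by (rule quotientI)

theorem mainTheorem7:
  fixes p :: real and n :: nat
    and X :: "(real ^ 'n) set"
    and u :: "real ^ 'n \<Rightarrow> ereal"
    and trunc :: "nat \<Rightarrow> real ^ 'n \<Rightarrow> ereal"
  assumes n_def: "n = CARD('n)" and n_ge_2: "2 \<le> n"
    and p_gt_1: "1 < p" and p_le_n: "p \<le> real n"
    and X_def: "X = ball 0 1 - {0}"
    and u_def: "\<And>x. x \<in> X \<Longrightarrow>
      u x = ereal (if p < real n then norm x powr (1 - real n / p) - 1 else ln (1 / norm x))"
    and trunc_def: "\<And>k x. x \<in> X \<Longrightarrow> trunc k x = min (u x) (ereal (real k))"
  shows "(\<forall>x\<in>X. 0 \<le> u x) \<and>
    u \<in> newtonian_functions p X \<and> newtonian_class p X u \<in> newtonian_space p X \<and>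
    (\<forall>k\<ge>1. trunc k \<in> newtonian_functions p X \<and>
            newtonian_class p X (trunc k) \<in> newtonian_space p X) \<and>
    \<not> newtonian_converges p X (\<lambda>k. newtonian_class p X (trunc k)) (newtonian_class p X u)"
proof -
  have dim: "real DIM(real ^ 'n) = real n" by (simp add: n_def)
  let ?\<phi> = "\<lambda>x::real ^ 'n. profile (real n) p (norm x)"
  note p = p_gt_1 p_le_n
  have u: "u x = ereal (?\<phi> x)" if "x \<in> X" for x
    using u_def[OF that] by (simp add: profile_def)
  have trunc: "trunc k x = ereal (min (?\<phi> x) (real k))" if "x \<in> X" for k x
    using trunc_def[OF that] by (simp add: u[OF that])
  have nonneg: "0 \<le> ?\<phi> x" and upper: "?\<phi> x \<le> norm x powr (- real n / p)" if "x \<in> X" for x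
    using that profile_nonneg[OF p, of "norm x"] profile_le[OF p, of "norm x"] by (auto simp: X_def)
  have Lip: "\<exists>d>0. \<forall>y\<in>X \<inter> ball x d. \<forall>z\<in>X \<inter> ball x d.
      \<bar>?\<phi> y - ?\<phi> z\<bar> \<le> (real n / p * norm x powr (- real n / p) + e) * dist y z"
    if "x \<in> X" "0 < e" for x e
    using profile_norm_local_Lipschitz[OF p, of x e] that by (auto simp: X_def)
  have cont: "continuous_on X ?\<phi>"
    unfolding profile_def by (cases "p < real n") (auto intro!: continuous_intros simp: X_def)
  have u_N: "u \<in> newtonian_functions p X"
  proof (rule newtonian_functionsI[OF _ _ X_def u], unfold dim)
    show "\<bar>?\<phi> x\<bar> \<le> norm x powr (- real n / p)" if "x \<in> X" for x
      using nonneg[OF that] upper[OF that] by simp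
    show "continuous_on X ?\<phi>" by (rule cont)
    show "\<exists>d>0. \<forall>y\<in>X \<inter> ball x d. \<forall>z\<in>X \<inter> ball x d.
        \<bar>?\<phi> y - ?\<phi> z\<bar> \<le> (real n / p * norm x powr (- real n / p) + e) * dist y z"
      if "x \<in> X" "0 < e" for x e
      by (rule Lip[OF that])
  qed (rule p)+
  have trunc_N: "trunc k \<in> newtonian_functions p X" for k
  proof (rule newtonian_functionsI[OF _ _ X_def trunc], unfold dim)
    show "continuous_on X (\<lambda>x. min (?\<phi> x) (real k))"
      by (intro continuous_intros cont)
    show "\<bar>min (?\<phi> x) (real k)\<bar> \<le> norm x powr (- real n / p)" if "x \<in> X" for x
      using nonneg[OF that] upper[OF that] by (auto simp: min_def)
    fix x and e :: real assume x: "x \<in> X" and e: "0 < e"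
    let ?L = "real n / p * norm x powr (- real n / p) + e"
    obtain d where d: "d > 0" "\<forall>y\<in>X \<inter> ball x d. \<forall>z\<in>X \<inter> ball x d. \<bar>?\<phi> y - ?\<phi> z\<bar> \<le> ?L * dist y z"
      using Lip[OF x e] by (elim exE conjE)
    show "\<exists>d>0. \<forall>y\<in>X \<inter> ball x d. \<forall>z\<in>X \<inter> ball x d.
        \<bar>min (?\<phi> y) (real k) - min (?\<phi> z) (real k)\<bar> \<le> ?L * dist y z"
    proof (intro exI[of _ d] conjI ballI d(1))
      fix y z assume "y \<in> X \<inter> ball x d" "z \<in> X \<inter> ball x d"
      then have "\<bar>?\<phi> y - ?\<phi> z\<bar> \<le> ?L * dist y z" by (rule d(2)[rule_format])
      moreover have "\<bar>min a c - min b c\<bar> \<le> \<bar>a - b\<bar>" for a b c :: real by (auto simp: min_def)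
      ultimately show "\<bar>min (?\<phi> y) (real k) - min (?\<phi> z) (real k)\<bar> \<le> ?L * dist y z"
        by (rule order_trans[rotated])
    qed
  qed (rule p)+
  define \<kappa> where "\<kappa> = profile (real n) p 3 - profile (real n) p 5"
  define c where "c = \<kappa> * unit_ball_vol (real n) * (p - 1) / (8 * (\<kappa> / 8) powr (1 - p))"
  have c: "0 < c"
    using profile_3_5[OF p] p by (simp add: c_def \<kappa>_def)
  have X_sets: "X \<in> sets borel" unfolding X_def by measurable
  have norm_bound: "ennreal (c powr (1 / p)) \<le> newtonian_norm p X (\<lambda>x. v x - w x)"
    if v: "(trunc k, v) \<in> newtonian_rel p X" and w: "(u, w) \<in> newtonian_rel p X" for k v w
  proof -
    have "AE x in lborel. x \<in> X \<longrightarrow> v x = trunc k x"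
      by (rule newtonian_rel_AE_eq[OF X_sets v]) (simp add: trunc del: ereal_min)
    moreover have "AE x in lborel. x \<in> X \<longrightarrow> w x = u x"
      by (rule newtonian_rel_AE_eq[OF X_sets w]) (simp add: u)
    ultimately have d: "AE x in lborel. x \<in> X \<longrightarrow> v x - w x = ereal (min (?\<phi> x) (real k) - ?\<phi> x)"
      by eventually_elim (simp add: trunc u del: ereal_min)
    have "ennreal c \<le> (INF g\<in>Lp_weak_upper_gradients p X (\<lambda>x. v x - w x).
        ennreal_rpow (weak_Lp_norm p X (\<lambda>x. enn2ereal (g x))) p)"
    proof (rule INF_greatest)
      fix g assume "g \<in> Lp_weak_upper_gradients p X (\<lambda>x. v x - w x)"
      then have "weak_upper_gradient p X (\<lambda>x. v x - w x) g"
        by (simp add: Lp_weak_upper_gradients_def)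
      then show "ennreal c \<le> ennreal_rpow (weak_Lp_norm p X (\<lambda>x. enn2ereal (g x))) p"
        unfolding c_def \<kappa>_def
        by (intro weak_upper_gradient_lower_bound[where k = "real k" and 'a = "real ^ 'n", unfolded dim, OF p X_def _ d]) simp_all
    qed
    then have "ennreal_rpow (ennreal c) (1 / p) \<le> newtonian_norm p X (\<lambda>x. v x - w x)"
      unfolding newtonian_norm_def using p by (intro ennreal_rpow_mono add_increasing) auto
    then show ?thesis using c by (simp add: ennreal_rpow_ennreal)
  qed
  have dist_bound: "ennreal (c powr (1 / p)) \<le> newtonian_dist p X (newtonian_class p X (trunc k)) (newtonian_class p X u)" for k
    unfolding newtonian_dist_def newtonian_class_def
    by (rule INF_greatest) (auto intro: norm_bound)
  have "\<not> newtonian_converges p X (\<lambda>k. newtonian_class p X (trunc k)) (newtonian_class p X u)"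
  proof
    assume "newtonian_converges p X (\<lambda>k. newtonian_class p X (trunc k)) (newtonian_class p X u)"
    then have "ennreal (c powr (1 / p)) \<le> 0"
      unfolding newtonian_converges_def by (rule LIMSEQ_le_const) (simp add: dist_bound)
    then show False using c by simp
  qed
  then show ?thesis
    using nonneg u u_N trunc_N by (auto intro: newtonian_class_in_space)
qed

end
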